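(* (i) Let $\nu\in\mathbb{C}\setminus\left(\{1-2n: n\in\mathbb{N}\}\cup\{2n:n\in\mathbb{N}\}\right)$. Then \[ \frac{\cot\left(\frac{\pi\nu}{2}\right)\Gamma\left(\frac{1+\nu}{2}\right)^{2}}{\pi\,\Gamma\left(\frac{2+\nu}{2}\right)^{2}}=\sum_{m\geq0}\left[\frac{1}{4^{m}}\binom{2m}{m}\right]^{3}\left(-1\right)^{m+1}\frac{\Gamma\left(m-\nu\right)\Gamma\left(m+\nu+1\right)\left(4m+1\right)}{\Gamma\left(m-\nu+\frac{1}{2}\right)\Gamma\left(m+\nu+\frac{3}{2}\right)}, \] where indeterminate forms are to be interpreted as limits. (ii) For $x\in[0,1]$, \[ K\left(x\right)K\left(1-x\right)=\frac{\pi^{3}}{8}\sum_{m\geq0}\left[\frac{1}{4^{m}}\binom{2m}{m}\right]^{4}\left(4m+1\right)P_{2m}\left(2x-1\right). \]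
   Context: $\Gamma$ is Euler's Gamma function, $\mathbb{N}$ denotes the natural numbers, $P_n$ is the Legendre polynomial of degree $n$, and $K$ is the complete elliptic integral of the first kind with the convention $K(x)=\int_{0}^{\pi/2}\frac{du}{\sqrt{1-x\sin^{2}u}}$. *)

theory Defs
  imports "HOL-Analysis.Analysis" "HOL-Computational_Algebra.Polynomial"
begin

text \<open>Rodrigues' formula.\<close>
definition legendre :: "nat \<Rightarrow> real poly" where
  "legendre n = smult (1 / (2 ^ n * fact n)) ((pderiv ^^ n) ([:-1, 0, 1:] ^ n))"

text \<open>
  The argument is the parameter \<open>x = k\<^sup>2\<close>, not the modulus \<open>k\<close>. The integral is taken in
  \<open>[0, \<infinity>]\<close>, so that \<open>ellK 1 = \<infinity>\<close>; only arguments \<open>x \<le> 1\<close> are meaningful. At \<open>x = 1\<close> the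
  integrand is given the value 0 at the single point \<open>u = \<pi>/2\<close>, which does not affect the integral.
\<close>
definition ellK :: "real \<Rightarrow> ennreal" where
  "ellK x = (\<integral>\<^sup>+ u\<in>{0..pi/2}. ennreal (1 / sqrt (1 - x * (sin u)\<^sup>2)) \<partial>lborel)"

definition ncbinom :: "nat \<Rightarrow> real" where
  "ncbinom m = 1 / 4 ^ m * real ((2 * m) choose m)"

definition cot_Gamma :: "complex \<Rightarrow> complex" where
  "cot_Gamma \<nu> =
     cot (of_real pi * \<nu> / 2) * (Gamma ((1 + \<nu>) / 2))\<^sup>2 / (of_real pi * (Gamma ((2 + \<nu>) / 2))\<^sup>2)"

text \<open>
  At a pole of a Gamma factor in the denominator (\<open>\<nu>\<close> a half-integer) the library conventions
  \<open>Gamma z = 0\<close> at poles and \<open>a / 0 = 0\<close> give the term 0, which is the correct value since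
  \<open>1/\<Gamma>\<close> is entire and vanishes there. At a pole of a Gamma factor in the numerator (\<open>\<nu>\<close> an
  integer) the value given by the same conventions is meaningless.
\<close>
definition Gamma_term :: "complex \<Rightarrow> nat \<Rightarrow> complex" where
  "Gamma_term \<nu> m =
     of_real (ncbinom m) ^ 3 * (-1) ^ (m + 1) *
     (Gamma (of_nat m - \<nu>) * Gamma (of_nat m + \<nu> + 1) * (4 * of_nat m + 1) /
      (Gamma (of_nat m - \<nu> + 1/2) * Gamma (of_nat m + \<nu> + 3/2)))"

end

theory Submission
  imports Defs "HOL-Real_Asymp.Real_Asymp" "HOL-Complex_Analysis.Complex_Analysis"
begin

text \<open>
  Fix \<open>0 < a < 1\<close>, put \<open>\<kappa> = a (1 - a)\<close>, and let \<open>u(x) = F(a, 1 - a; 1; x)\<close>, that is, the Legendre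
  function of degree \<open>\<nu> = - a\<close> at \<open>1 - 2 x\<close>. Both parts come from the Legendre expansion of the product
  \<open>W(x) = u(x) u(1 - x)\<close>. Since \<open>u(x)\<close> and \<open>u(1 - x)\<close> solve the same second order equation, \<open>W\<close> solves
  a third order one, which turns into the two-term recurrence
  \<open>(n + 1)\<^sup>2 (n (n + 2) + 4 \<kappa>) w\<^sub>n\<^sub>+\<^sub>1 = n\<^sup>2 (n\<^sup>2 - 1 + 4 \<kappa>) w\<^sub>n\<^sub>-\<^sub>1\<close>
  for the coefficients \<open>w\<^sub>n = \<integral> W(x) P\<^sub>n(2 x - 1) dx\<close> over \<open>[0, 1]\<close>. Gauss's summation theorem gives the
  moments of \<open>u(1 - x)\<close> and reduces \<open>w\<^sub>0\<close> to the partial fractions of the cotangent. The resulting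
  Legendre series converges uniformly after multiplication with \<open>x (1 - x)\<close>, because
  \<open>(1 - t\<^sup>2) P\<^sub>2\<^sub>m(t)\<^sup>2 \<le> P\<^sub>2\<^sub>m(0)\<^sup>2\<close> on \<open>[-1, 1]\<close>, and equals \<open>W\<close> because its moments do.

  The case \<open>a = 1/2\<close>, where \<open>u = 2 K / \<pi>\<close>, is part (ii). The value at \<open>x = 1/2\<close> is part (i) for real \<open>\<nu>\<close>
  between \<open>- 1\<close> and \<open>0\<close>; the general case follows by analytic continuation to the complement of the
  integers.
\<close>

section \<open>Central binomial coefficients\<close>

lemma ncbinom_eq_pochhammer: "ncbinom m = pochhammer (1/2) m / fact m"
proof -
  have "ncbinom m = fact (2 * m) / (4 ^ m * (fact m * fact m))"
    by (simp add: ncbinom_def binomial_fact mult_2)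
  also have "\<dots> = pochhammer (1/2) m / fact m"
    by (simp add: fact_double power_mult)
  finally show ?thesis .
qed

lemma ncbinom_0 [simp]: "ncbinom 0 = 1"
  by (simp add: ncbinom_def)

lemma ncbinom_pos [simp]: "ncbinom m > 0"
  by (simp add: ncbinom_def)

lemma ncbinom_nonneg [simp]: "ncbinom m \<ge> 0"
  by (rule less_imp_le[OF ncbinom_pos])

lemma ncbinom_Suc: "ncbinom (Suc m) = ncbinom m * ((2 * real m + 1) / (2 * real m + 2))"
  by (simp add: ncbinom_eq_pochhammer pochhammer_Suc field_simps)

lemma ncbinom_square_le: "(ncbinom m)\<^sup>2 \<le> 1 / (2 * real m + 1)"
proof (induction m)
  case (Suc m)
  have "(ncbinom (Suc m))\<^sup>2 \<le> 1 / (2 * real m + 1) * ((2 * real m + 1) / (2 * real m + 2))\<^sup>2"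
    unfolding ncbinom_Suc power_mult_distrib by (intro mult_right_mono Suc.IH zero_le_power2)
  also have "\<dots> = (2 * real m + 1) / (2 * real m + 2)\<^sup>2"
    by (simp add: power2_eq_square add_nonneg_eq_0_iff)
  also have "\<dots> \<le> 1 / (2 * real (Suc m) + 1)"
    by (simp add: divide_simps) (simp add: power2_eq_square algebra_simps)
  finally show ?case .
qed simp

lemma ncbinom_square_ge: "1 / (4 * real m + 1) \<le> (ncbinom m)\<^sup>2"
proof (induction m)
  case (Suc m)
  have "1 / (4 * real (Suc m) + 1) \<le>
      1 / (4 * real m + 1) * ((2 * real m + 1) / (2 * real m + 2))\<^sup>2"
    by (simp add: divide_simps power2_eq_square) (simp add: algebra_simps)
  also have "\<dots> \<le> (ncbinom (Suc m))\<^sup>2"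
    unfolding ncbinom_Suc power_mult_distrib by (intro mult_right_mono Suc.IH zero_le_power2)
  finally show ?case .
qed simp

lemma summable_ncbinom_cube: "summable (\<lambda>m. ncbinom m ^ 3)"
proof (rule summable_comparison_test')
  show "summable (\<lambda>m. real (Suc m) powr (- 3/2))"
    using summable_Suc_iff[of "\<lambda>m. real m powr (- 3/2)"] summable_real_powr_iff[of "- 3/2"]
    by simp
  show "norm (ncbinom m ^ 3) \<le> real (Suc m) powr (- 3/2)" for m
  proof -
    have "(ncbinom m)\<^sup>2 \<le> 1 / real (Suc m)"
      by (rule order_trans[OF ncbinom_square_le]) (simp add: divide_simps)
    also have "\<dots> = (real (Suc m) powr (- 1/2))\<^sup>2"
      by (simp add: powr_power powr_minus divide_simps)
    finally have "ncbinom m \<le> real (Suc m) powr (- 1/2)"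
      by (rule power2_le_imp_le) simp
    then have "ncbinom m ^ 3 \<le> (real (Suc m) powr (- 1/2)) ^ 3"
      by (intro power_mono) simp_all
    then show ?thesis by (simp add: powr_power)
  qed
qed

lemma not_summable_ncbinom_square: "\<not> summable (\<lambda>m. (ncbinom m)\<^sup>2)"
proof
  assume "summable (\<lambda>m. (ncbinom m)\<^sup>2)"
  then have "summable (\<lambda>m. 1 / (4 * real m + 1))"
    by (rule summable_comparison_test'[where N = 0]) (simp add: ncbinom_square_ge)
  then have "summable (\<lambda>m. 4 * (1 / (4 * real m + 1)))" by (rule summable_mult)
  then have "summable (\<lambda>m. 1 / real (Suc m))"
    by (rule summable_comparison_test'[where N = 0]) (simp add: divide_simps)
  then show False
    using not_summable_harmonic[where 'a = real] summable_Suc_iff[of "\<lambda>m. 1 / real m"]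
    by (simp add: inverse_eq_divide)
qed

section \<open>Legendre polynomials\<close>

lemma higher_pderiv_pCons_0:
  "(pderiv ^^ n) (pCons 0 p) =
     pCons 0 ((pderiv ^^ n) p) + smult (of_nat n) ((pderiv ^^ (n - 1)) p)"
proof (induction n)
  case (Suc n)
  have "smult (of_nat n) (pderiv ((pderiv ^^ (n - 1)) p)) = smult (of_nat n) ((pderiv ^^ n) p)"
    by (cases n) simp_all
  then show ?case
    by (simp add: Suc.IH pderiv_add pderiv_smult pderiv_pCons smult_add_left ac_simps)
qed simp

lemma higher_pderiv_quadratic_mult:
  fixes p :: "'a::idom poly"
  shows "(pderiv ^^ Suc n) ([:-1, 0, 1:] * p) = [:-1, 0, 1:] * (pderiv ^^ Suc n) p
    + smult (2 * of_nat (Suc n)) (pCons 0 ((pderiv ^^ n) p))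
    + smult (of_nat (Suc n) * of_nat n) ((pderiv ^^ (n - 1)) p)"
proof -
  have quadratic: "[:-1, 0, 1:] * p = pCons 0 (pCons 0 p) + smult (-1) p" for p :: "'a poly"
    by simp
  have "(pderiv ^^ Suc n) (pCons 0 (pCons 0 p)) = pCons 0 (pCons 0 ((pderiv ^^ Suc n) p))
      + smult (2 * of_nat (Suc n)) (pCons 0 ((pderiv ^^ n) p))
      + smult (of_nat (Suc n) * of_nat n) ((pderiv ^^ (n - 1)) p)"
    by (simp only: higher_pderiv_pCons_0 diff_Suc_1 smult_add_right smult_smult smult_pCons
        add_pCons mult_2 smult_add_left) (simp add: ac_simps)
  then show ?thesis
    unfolding quadratic higher_pderiv_add higher_pderiv_smult by (simp only: ac_simps)
qed

lemma legendre_0 [simp]: "legendre 0 = 1"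
  by (simp add: legendre_def)

lemma higher_pderiv_quadratic_power_eq:
  "(pderiv ^^ n) ([:-1, 0, 1::real:] ^ n) = smult (2 ^ n * fact n) (legendre n)"
  by (simp add: legendre_def)

lemma pderiv_quadratic_power_Suc:
  "pderiv ([:-1, 0, 1::real:] ^ Suc n) = smult (2 * real (Suc n)) (pCons 0 ([:-1, 0, 1:] ^ n))"
proof -
  have "pderiv [:-1, 0, 1::real:] = smult 2 [:0, 1:]" by (simp add: pderiv_pCons)
  then show ?thesis by (simp add: pderiv_power_Suc del: power_Suc of_nat_Suc)
qed

lemma pderiv_legendre_Suc:
  "pderiv (legendre (Suc n)) = pCons 0 (pderiv (legendre n)) + smult (real (Suc n)) (legendre n)"
proof -
  let ?s = "[:-1, 0, 1::real:]"
  define c :: real where "c = 2 * real (Suc n) * (2 ^ n * fact n)"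
  have "c \<noteq> 0" by (simp add: c_def del: of_nat_Suc)
  have "smult c (pderiv (legendre (Suc n))) = pderiv ((pderiv ^^ Suc n) (?s ^ Suc n))"
    unfolding higher_pderiv_quadratic_power_eq pderiv_smult by (simp add: c_def algebra_simps)
  also have "\<dots> = (pderiv ^^ Suc n) (pderiv (?s ^ Suc n))"
    by (simp only: funpow.simps o_apply funpow_swap1)
  also have "\<dots> = smult (2 * real (Suc n))
      (pCons 0 (pderiv ((pderiv ^^ n) (?s ^ n))) + smult (real (Suc n)) ((pderiv ^^ n) (?s ^ n)))"
    unfolding pderiv_quadratic_power_Suc higher_pderiv_smult higher_pderiv_pCons_0 by simp
  also have "\<dots> = smult c (pCons 0 (pderiv (legendre n)) + smult (real (Suc n)) (legendre n))"
    unfolding higher_pderiv_quadratic_power_eq pderiv_smult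
    by (simp add: c_def smult_add_right ac_simps del: of_nat_Suc)
  finally show ?thesis using \<open>c \<noteq> 0\<close> by (simp only: smult_cancel)
qed

lemma higher_pderiv_quadratic_power_Suc:
  "(pderiv ^^ Suc n) ([:-1, 0, 1::real:] ^ Suc n) = smult (2 * real (Suc n))
     (pCons 0 ((pderiv ^^ n) ([:-1, 0, 1:] ^ n))
      + smult (real n) ((pderiv ^^ (n - 1)) ([:-1, 0, 1:] ^ n)))"
proof -
  have "(pderiv ^^ Suc n) ([:-1, 0, 1::real:] ^ Suc n) =
      (pderiv ^^ n) (pderiv ([:-1, 0, 1:] ^ Suc n))"
    by (simp only: funpow_Suc_right o_apply)
  then show ?thesis
    unfolding pderiv_quadratic_power_Suc higher_pderiv_smult higher_pderiv_pCons_0 .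
qed

text \<open>The derivative of order \<open>n + 1\<close> of \<open>(X\<^sup>2 - 1)\<^sup>n\<^sup>+\<^sup>1\<close> is computed in two ways, from the derivative of
  the power and from its factor \<open>X\<^sup>2 - 1\<close>; the derivative of order \<open>n - 1\<close> of \<open>(X\<^sup>2 - 1)\<^sup>n\<close> is then
  eliminated.\<close>
lemma legendre_Suc_eq:
  "smult (real (Suc n)) (legendre (Suc n)) =
     [:-1, 0, 1:] * pderiv (legendre n) + smult (real (Suc n)) (pCons 0 (legendre n))"
proof -
  let ?s = "[:-1, 0, 1::real:]"
  define c :: real where "c = 2 ^ n * fact n"
  have "c \<noteq> 0" by (simp add: c_def)
  have c_Suc: "2 ^ Suc n * fact (Suc n) = 2 * real (Suc n) * c" by (simp add: c_def)
  define L where "L = (pderiv ^^ (n - 1)) (?s ^ n)"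
  have by_power: "(pderiv ^^ Suc n) (?s ^ Suc n) =
      smult (2 * real (Suc n)) (pCons 0 (smult c (legendre n)) + smult (real n) L)"
    using higher_pderiv_quadratic_power_Suc[of n]
    unfolding higher_pderiv_quadratic_power_eq[of n] L_def c_def .
  have by_product: "(pderiv ^^ Suc n) (?s ^ Suc n) =
      ?s * smult c (pderiv (legendre n)) + smult (2 * real (Suc n)) (pCons 0 (smult c (legendre n)))
      + smult (real (Suc n) * real n) L"
    using higher_pderiv_quadratic_mult[of n "?s ^ n"]
    unfolding higher_pderiv_quadratic_power_eq c_def L_def funpow.simps o_apply pderiv_smult
      power_Suc[symmetric] .
  have "real (Suc n) * poly (legendre (Suc n)) t =
      (t\<^sup>2 - 1) * poly (pderiv (legendre n)) t + real (Suc n) * (t * poly (legendre n) t)" for t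
  proof -
    have "2 * real (Suc n) * c * poly (legendre (Suc n)) t =
        2 * real (Suc n) * (t * (c * poly (legendre n) t) + real n * poly L t)"
      using arg_cong[OF by_power, of "\<lambda>p. poly p t"]
      unfolding higher_pderiv_quadratic_power_eq c_Suc
      by (simp only: poly_smult poly_add poly_pCons add_0_left)
    moreover have "2 * real (Suc n) * c * poly (legendre (Suc n)) t =
        (t\<^sup>2 - 1) * c * poly (pderiv (legendre n)) t
        + 2 * real (Suc n) * (t * (c * poly (legendre n) t)) + real (Suc n) * real n * poly L t"
      using arg_cong[OF by_product, of "\<lambda>p. poly p t"]
      unfolding higher_pderiv_quadratic_power_eq c_Suc
      by (simp add: power2_eq_square algebra_simps)
    ultimately have "c * (real (Suc n) * poly (legendre (Suc n)) t) = c * ((t\<^sup>2 - 1) *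
        poly (pderiv (legendre n)) t + real (Suc n) * (t * poly (legendre n) t))"
      by algebra
    then show ?thesis using \<open>c \<noteq> 0\<close> by simp
  qed
  then show ?thesis
    unfolding poly_eq_poly_eq_iff[symmetric]
    by (simp add: fun_eq_iff power2_eq_square algebra_simps)
qed

lemma legendre_1 [simp]: "legendre (Suc 0) = [:0, 1:]"
  using legendre_Suc_eq[of 0] by simp

lemma poly_pderiv_legendre_Suc:
  "poly (pderiv (legendre (Suc n))) t =
     t * poly (pderiv (legendre n)) t + real (Suc n) * poly (legendre n) t"
  by (simp add: pderiv_legendre_Suc)

lemma quadratic_mult_pderiv_legendre_Suc:
  "(t\<^sup>2 - 1) * poly (pderiv (legendre n)) t =
     real (Suc n) * (poly (legendre (Suc n)) t - t * poly (legendre n) t)"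
  using arg_cong[OF legendre_Suc_eq[of n], of "\<lambda>p. poly p t"]
  by (simp add: power2_eq_square algebra_simps)

lemma quadratic_mult_pderiv_legendre:
  "(t\<^sup>2 - 1) * poly (pderiv (legendre n)) t =
     real n * (t * poly (legendre n) t - poly (legendre (n - 1)) t)"
proof (cases n)
  case (Suc m)
  have "(t\<^sup>2 - 1) * poly (pderiv (legendre n)) t = t * ((t\<^sup>2 - 1) * poly (pderiv (legendre m)) t)
      + (t\<^sup>2 - 1) * (real n * poly (legendre m) t)"
    unfolding Suc poly_pderiv_legendre_Suc by algebra
  also have "\<dots> = real n * (t * poly (legendre n) t - poly (legendre m) t)"
    unfolding quadratic_mult_pderiv_legendre_Suc Suc by algebra
  finally show ?thesis by (simp add: Suc)
qed simp

lemma legendre_three_term: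
  "real (2 * n + 1) * (t * poly (legendre n) t) =
     real (n + 1) * poly (legendre (n + 1)) t + real n * poly (legendre (n - 1)) t"
  using quadratic_mult_pderiv_legendre_Suc[of t n] quadratic_mult_pderiv_legendre[of t n]
  by (simp add: algebra_simps)

lemma legendre_ode:
  "pderiv ([:-1, 0, 1:] * pderiv (legendre n)) = smult (real n * real (n + 1)) (legendre n)"
proof -
  have "[:-1, 0, 1:] * pderiv (legendre n) =
      smult (real (Suc n)) (legendre (Suc n)) - smult (real (Suc n)) (pCons 0 (legendre n))"
    unfolding legendre_Suc_eq by simp
  then have "pderiv ([:-1, 0, 1:] * pderiv (legendre n)) = smult (real (Suc n))
      (pderiv (legendre (Suc n)) - (legendre n + pCons 0 (pderiv (legendre n))))"
    by (simp only: pderiv_diff pderiv_smult pderiv_pCons smult_diff_right)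
  also have "\<dots> = smult (real n * real (n + 1)) (legendre n)"
    unfolding pderiv_legendre_Suc poly_eq_poly_eq_iff[symmetric]
    by (simp add: fun_eq_iff algebra_simps)
  finally show ?thesis .
qed

lemma poly_legendre_1 [simp]: "poly (legendre n) 1 = 1"
proof (induction n)
  case (Suc n)
  then show ?case using quadratic_mult_pderiv_legendre_Suc[of 1 n] by simp
qed simp

lemma poly_legendre_minus: "poly (legendre n) (- t) = (-1) ^ n * poly (legendre n) t"
proof (induction n rule: induct_nat_012)
  case (ge2 n)
  have "real (n + 2) * poly (legendre (n + 2)) (- t) =
      (-1) ^ n * (real (2 * n + 3) * (t * poly (legendre (n + 1)) t)
        - real (n + 1) * poly (legendre n) t)"
    using legendre_three_term[of "n + 1" "- t"] ge2 by (simp add: algebra_simps)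
  also have "\<dots> = real (n + 2) * ((-1) ^ (n + 2) * poly (legendre (n + 2)) t)"
    using legendre_three_term[of "n + 1" t] by (simp add: algebra_simps)
  finally show ?case by (simp del: of_nat_add)
qed simp_all

text \<open>By the differential equation \<open>n (n + 1) (1 - t\<^sup>2) P\<^sub>n\<^sup>2 + (1 - t\<^sup>2)\<^sup>2 P\<^sub>n'\<^sup>2\<close> has derivative
  \<open>- 2 n (n + 1) t P\<^sub>n\<^sup>2\<close>.\<close>
lemma legendre_bound_nonneg:
  assumes "0 \<le> t" "t \<le> 1"
  shows "real n * real (n + 1) * ((1 - t\<^sup>2) * (poly (legendre n) t)\<^sup>2) \<le>
    real n * real (n + 1) * (poly (legendre n) 0)\<^sup>2 + (poly (pderiv (legendre n)) 0)\<^sup>2"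
proof -
  define P where "P = poly (legendre n)"
  define D where "D t = (t\<^sup>2 - 1) * poly (pderiv (legendre n)) t" for t
  define k where "k = real n * real (n + 1)"
  define E where "E t = k * ((1 - t\<^sup>2) * (P t)\<^sup>2) + (D t)\<^sup>2" for t
  have D_deriv: "(D has_real_derivative k * P t) (at t)" for t
  proof -
    have "D = poly ([:-1, 0, 1:] * pderiv (legendre n))"
      by (simp add: D_def fun_eq_iff power2_eq_square algebra_simps)
    moreover have "poly (pderiv ([:-1, 0, 1:] * pderiv (legendre n))) t = k * P t"
      unfolding legendre_ode by (simp add: k_def P_def)
    ultimately show ?thesis by (metis poly_DERIV)
  qed
  have P_deriv: "(P has_real_derivative poly (pderiv (legendre n)) t) (at t)" for t
    unfolding P_def by (rule poly_DERIV)
  have E_deriv: "(E has_real_derivative - (2 * k * t * (P t)\<^sup>2)) (at t)" for t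
    unfolding E_def
    by (rule derivative_eq_intros D_deriv P_deriv refl)+
       (simp add: D_def power2_eq_square algebra_simps)
  have "E t \<le> E 0"
  proof (rule DERIV_nonpos_imp_nonincreasing[OF assms(1)])
    fix s :: real assume "0 \<le> s"
    then show "\<exists>y. (E has_real_derivative y) (at s) \<and> y \<le> 0"
      by (intro exI[of _ "- (2 * k * s * (P s)\<^sup>2)"] conjI E_deriv) (simp add: k_def)
  qed
  moreover have "k * ((1 - t\<^sup>2) * (P t)\<^sup>2) \<le> E t" by (simp add: E_def)
  moreover have "E 0 = k * (P 0)\<^sup>2 + (poly (pderiv (legendre n)) 0)\<^sup>2" by (simp add: E_def D_def)
  ultimately show ?thesis by (simp add: P_def k_def)
qed

lemma legendre_bound:
  assumes "\<bar>t\<bar> \<le> 1"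
  shows "real n * real (n + 1) * ((1 - t\<^sup>2) * (poly (legendre n) t)\<^sup>2) \<le>
    real n * real (n + 1) * (poly (legendre n) 0)\<^sup>2 + (poly (pderiv (legendre n)) 0)\<^sup>2"
proof -
  have "(poly (legendre n) \<bar>t\<bar>)\<^sup>2 = (poly (legendre n) t)\<^sup>2"
    by (cases "0 \<le> t") (simp_all add: poly_legendre_minus power_mult_distrib power2_eq_square)
  then show ?thesis using legendre_bound_nonneg[of "\<bar>t\<bar>" n] assms by simp
qed

lemma poly_legendre_even_0: "poly (legendre (2 * m)) 0 = (-1) ^ m * ncbinom m"
proof (induction m)
  case (Suc m)
  have "real (2 * m + 2) * poly (legendre (2 * Suc m)) 0 =
      - real (2 * m + 1) * ((-1) ^ m * ncbinom m)"
    using legendre_three_term[of "2 * m + 1" 0] Suc.IH by (simp add: algebra_simps)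
  then show ?case unfolding ncbinom_Suc by (simp add: field_simps)
qed simp

lemma poly_pderiv_legendre_even_0: "poly (pderiv (legendre (2 * m))) 0 = 0"
proof -
  have "poly (legendre (Suc (2 * m))) 0 = 0" using poly_legendre_minus[of "Suc (2 * m)" 0] by simp
  then show ?thesis using quadratic_mult_pderiv_legendre_Suc[of 0 "2 * m"] by simp
qed

lemma legendre_even_bound:
  assumes "\<bar>t\<bar> \<le> 1"
  shows "\<bar>(1 - t\<^sup>2) * poly (legendre (2 * m)) t\<bar> \<le> ncbinom m"
proof (rule abs_le_square_iff[THEN iffD2, of _ "ncbinom m", simplified])
  let ?P = "poly (legendre (2 * m)) t"
  have t: "0 \<le> 1 - t\<^sup>2" "1 - t\<^sup>2 \<le> 1" using assms by (simp_all add: abs_square_le_1)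
  have "((1 - t\<^sup>2) * ?P)\<^sup>2 \<le> (1 - t\<^sup>2) * ?P\<^sup>2"
    unfolding power_mult_distrib using t by (intro mult_right_mono)
        (simp_all add: power2_eq_square mult_left_le)
  also have "\<dots> \<le> (ncbinom m)\<^sup>2"
  proof (cases "m = 0")
    case False
    define k where "k = real (2 * m) * real (2 * m + 1)"
    have "k * ((1 - t\<^sup>2) * ?P\<^sup>2) \<le> k * (ncbinom m)\<^sup>2"
      using legendre_bound[OF assms, of "2 * m"]
      unfolding poly_legendre_even_0 poly_pderiv_legendre_even_0 k_def
      by (simp only: power_mult_distrib) (simp flip: power_mult)
    then show ?thesis using False by (simp add: k_def)
  qed (use t in simp)
  finally show "((1 - t\<^sup>2) * ?P)\<^sup>2 \<le> (ncbinom m)\<^sup>2" .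
qed

section \<open>Shifted Legendre polynomials\<close>

definition shifted_legendre :: "nat \<Rightarrow> real poly" where
  "shifted_legendre n = pcompose (legendre n) [:-1, 2:]"

lemma poly_shifted_legendre: "poly (shifted_legendre n) x = poly (legendre n) (2 * x - 1)"
  by (simp add: shifted_legendre_def poly_pcompose algebra_simps)

lemma shifted_legendre_0 [simp]: "shifted_legendre 0 = 1"
  by (simp add: shifted_legendre_def pcompose_1)

lemma quadratic_mult_pderiv_shifted_legendre:
  "[:0, 1, -1:] * pderiv (shifted_legendre n) =
     smult (- 1/2) (pcompose ([:-1, 0, 1:] * pderiv (legendre n)) [:-1, 2:])"
  unfolding poly_eq_poly_eq_iff[symmetric]
  by (simp add: fun_eq_iff shifted_legendre_def pderiv_pcompose pderiv_pCons poly_pcompose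
      algebra_simps)

lemma shifted_legendre_ode:
  "pderiv ([:0, 1, -1:] * pderiv (shifted_legendre n)) =
     smult (- (real n * real (n + 1))) (shifted_legendre n)"
proof -
  have "pderiv [:-1, 2::real:] = [:2:]" by (simp add: pderiv_pCons)
  then show ?thesis
    unfolding quadratic_mult_pderiv_shifted_legendre pderiv_smult pderiv_pcompose legendre_ode
    by (simp add: pcompose_smult shifted_legendre_def)
qed

lemma quadratic_mult_pderiv_shifted_legendre_eq_diff:
  "[:0, 1, -1:] * pderiv (shifted_legendre n) =
      smult (real n * real (n + 1) / (2 * real (2 * n + 1)))
     (shifted_legendre (n - 1) - shifted_legendre (n + 1))"
proof -
  have "real (2 * n + 1) * ((t\<^sup>2 - 1) * poly (pderiv (legendre n)) t) =
      real n * real (n + 1) * (poly (legendre (n + 1)) t - poly (legendre (n - 1)) t)" for t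
  proof -
    have "real (2 * n + 1) * ((t\<^sup>2 - 1) * poly (pderiv (legendre n)) t) =
        real n * ((t\<^sup>2 - 1) * poly (pderiv (legendre n)) t)
        + real (n + 1) * ((t\<^sup>2 - 1) * poly (pderiv (legendre n)) t)"
      by (simp add: algebra_simps)
    then show ?thesis
      by (subst (asm) (2) quadratic_mult_pderiv_legendre_Suc,
          subst (asm) (2) quadratic_mult_pderiv_legendre) (simp add: algebra_simps)
  qed
  then have "(t\<^sup>2 - 1) * poly (pderiv (legendre n)) t = real n * real (n + 1) / real (2 * n + 1) *
      (poly (legendre (n + 1)) t - poly (legendre (n - 1)) t)" for t
    by (simp add: eq_divide_eq ac_simps del: of_nat_add)
  moreover have "poly ([:-1, 0, 1:] * p) t = (t\<^sup>2 - 1) * poly p t" for p and t :: real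
    by (simp add: power2_eq_square algebra_simps)
  ultimately have "poly ([:-1, 0, 1:] * pderiv (legendre n)) t = real n * real (n + 1) /
      real (2 * n + 1) * (poly (legendre (n + 1)) t - poly (legendre (n - 1)) t)" for t
    by (simp only:)
  moreover have "poly [:-1, 2:] x = 2 * x - 1" for x :: real by simp
  moreover have "- 1/2 * (c / d * (y - z)) = c / (2 * d) * (z - y)" for c d y z :: real
    by (cases "d = 0") (simp_all add: field_simps)
  ultimately show ?thesis
    unfolding quadratic_mult_pderiv_shifted_legendre
    by (intro poly_ext)
       (simp only: poly_smult poly_pcompose poly_diff poly_shifted_legendre)
qed

lemma linear_mult_shifted_legendre:
  "[:-1, 2:] * shifted_legendre n = smult (1 / real (2 * n + 1))
     (smult (real (n + 1)) (shifted_legendre (n + 1)) + smult (real n) (shifted_legendre (n - 1)))"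
proof -
  have "t * poly (legendre n) t = 1 / real (2 * n + 1) *
      (real (n + 1) * poly (legendre (n + 1)) t + real n * poly (legendre (n - 1)) t)" for t
    unfolding legendre_three_term[symmetric] by (simp del: of_nat_add)
  moreover have "poly [:-1, 2:] x = 2 * x - 1" for x :: real by simp
  ultimately show ?thesis
    by (intro poly_ext)
       (simp only: poly_mult poly_smult poly_add poly_shifted_legendre)
qed

lemma shifted_legendre_induct [case_names add smult shifted_legendre]:
  assumes add: "\<And>p r. P p \<Longrightarrow> P r \<Longrightarrow> P (p + r)"
    and smult: "\<And>c p. P p \<Longrightarrow> P (smult c p)"
    and shifted_legendre: "\<And>n. P (shifted_legendre n)"
  shows "P p"
proof -
  have "P (r * shifted_legendre n)" for r n
  proof (induction r arbitrary: n)
    case 0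
    show ?case using smult[of _ 0, OF shifted_legendre] by simp
  next
    case (pCons c r)
    have X: "pCons 0 (shifted_legendre n) = smult (1/2) (shifted_legendre n)
        + smult (1/2) ([:-1, 2:] * shifted_legendre n)"
      unfolding poly_eq_poly_eq_iff[symmetric] by (simp add: fun_eq_iff algebra_simps)
    have "pCons c r * shifted_legendre n =
        smult c (shifted_legendre n) + r * pCons 0 (shifted_legendre n)"
      by simp
    also have "\<dots> = smult c (shifted_legendre n) + (smult (1/2) (r * shifted_legendre n)
        + smult (1/2) (smult (1 / real (2 * n + 1))
          (smult (real (n + 1)) (r * shifted_legendre (n + 1))
           + smult (real n) (r * shifted_legendre (n - 1)))))"
      unfolding X linear_mult_shifted_legendre by (simp only: distrib_left mult_smult_right)
    finally show ?case by (simp only:) (intro add smult shifted_legendre pCons.IH)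
  qed
  from this[of p 0] show ?thesis by simp
qed

definition poly_inner :: "real poly \<Rightarrow> real poly \<Rightarrow> real" where
  "poly_inner p r = integral {0..1} (\<lambda>x. poly p x * poly r x)"

lemma has_integral_poly_inner: "((\<lambda>x. poly p x * poly r x) has_integral poly_inner p r) {0..1}"
  unfolding poly_inner_def
  by (intro integrable_integral integrable_continuous_interval continuous_intros)

lemma poly_inner_commute: "poly_inner p r = poly_inner r p"
  by (simp add: poly_inner_def mult.commute)

lemma poly_inner_mult_left: "poly_inner (s * p) r = poly_inner p (s * r)"
  by (simp add: poly_inner_def ac_simps)

lemma poly_inner_add_right: "poly_inner p (r + s) = poly_inner p r + poly_inner p s"
proof (rule has_integral_unique[OF has_integral_poly_inner])
  show "((\<lambda>x. poly p x * poly (r + s) x) has_integral poly_inner p r + poly_inner p s) {0..1}"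
    unfolding poly_add distrib_left by (intro has_integral_add has_integral_poly_inner)
qed

lemma poly_inner_smult_right: "poly_inner p (smult c r) = c * poly_inner p r"
  by (simp add: poly_inner_def mult.left_commute)

lemma poly_inner_smult_left: "poly_inner (smult c p) r = c * poly_inner p r"
  by (simp add: poly_inner_def mult.assoc)

text \<open>Both sides differ by the integral of the derivative of \<open>x (1 - x) (p' r - p r')\<close>.\<close>
lemma poly_inner_sturm_liouville:
  "poly_inner (pderiv ([:0, 1, -1:] * pderiv p)) r =
      poly_inner p (pderiv ([:0, 1, -1:] * pderiv r))"
proof -
  define A where "A = [:0, 1, -1:] * pderiv p"
  define B where "B = [:0, 1, -1:] * pderiv r"
  define s where "s = A * r - p * B"
  have "(poly (pderiv s) has_integral poly s 1 - poly s 0) {0..1}"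
  proof (rule fundamental_theorem_of_calculus)
    show "(poly s has_vector_derivative poly (pderiv s) x) (at x within {0..1})" for x
      unfolding has_real_derivative_iff_has_vector_derivative[symmetric]
      by (rule has_field_derivative_at_within[OF poly_DERIV])
  qed simp
  moreover have "poly A 0 = 0" "poly A 1 = 0" "poly B 0 = 0" "poly B 1 = 0"
    by (simp_all add: A_def B_def)
  then have "poly s 1 - poly s 0 = 0" by (simp add: s_def)
  moreover have "pderiv s = pderiv A * r - p * pderiv B"
  proof -
    have swap: "A * pderiv r = B * pderiv p" by (simp only: A_def B_def ac_simps)
    have "pderiv s = A * pderiv r + r * pderiv A - (p * pderiv B + B * pderiv p)"
      unfolding s_def pderiv_diff pderiv_mult ..
    then show ?thesis unfolding swap by (simp only: ac_simps add_diff_cancel_left)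
  qed
  then have "poly (pderiv s) = (\<lambda>x. poly (pderiv A) x * poly r x - poly p x * poly (pderiv B) x)"
    by (simp add: fun_eq_iff)
  ultimately have "((\<lambda>x. poly (pderiv A) x * poly r x - poly p x * poly (pderiv B) x)
      has_integral 0) {0..1}"
    by (simp only:)
  moreover have "((\<lambda>x. poly (pderiv A) x * poly r x - poly p x * poly (pderiv B) x)
      has_integral poly_inner (pderiv A) r - poly_inner p (pderiv B)) {0..1}"
    by (intro has_integral_diff has_integral_poly_inner)
  ultimately have "poly_inner (pderiv A) r - poly_inner p (pderiv B) = 0"
    by (rule has_integral_unique[symmetric])
  then show ?thesis by (simp add: A_def B_def)
qed

lemma poly_inner_shifted_legendre_neq:
  assumes "n \<noteq> m"
  shows "poly_inner (shifted_legendre n) (shifted_legendre m) = 0"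
proof -
  have "real n * real (n + 1) * poly_inner (shifted_legendre n) (shifted_legendre m) =
      real m * real (m + 1) * poly_inner (shifted_legendre n) (shifted_legendre m)"
    using poly_inner_sturm_liouville[of "shifted_legendre n" "shifted_legendre m"]
    unfolding shifted_legendre_ode poly_inner_smult_left poly_inner_smult_right by simp
  moreover have "real n * real (n + 1) \<noteq> real m * real (m + 1)"
  proof
    assume "real n * real (n + 1) = real m * real (m + 1)"
    then have "(real m - real n) * (real m + real n + 1) = 0" by (simp add: algebra_simps)
    then show False using assms by (simp add: add_nonneg_eq_0_iff)
  qed
  ultimately show ?thesis by simp
qed

lemma poly_inner_shifted_legendre_same:
  "poly_inner (shifted_legendre n) (shifted_legendre n) = 1 / real (2 * n + 1)"
proof (induction n)
  case 0
  show ?case by (simp add: poly_inner_def)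
next
  case (Suc n)
  let ?Q = shifted_legendre and ?t = "[:-1, 2::real:]"
  have "poly_inner (?Q n) (?t * ?Q (Suc n)) =
      real (Suc n) / real (2 * n + 3) * poly_inner (?Q n) (?Q n)"
    unfolding linear_mult_shifted_legendre
    by (simp add: poly_inner_smult_right poly_inner_add_right poly_inner_shifted_legendre_neq
        add.commute)
  moreover have "poly_inner (?Q (Suc n)) (?t * ?Q n) =
      real (Suc n) / real (2 * n + 1) * poly_inner (?Q (Suc n)) (?Q (Suc n))"
    unfolding linear_mult_shifted_legendre
    by (simp add: poly_inner_smult_right poly_inner_add_right poly_inner_shifted_legendre_neq)
  moreover have "poly_inner (?Q n) (?t * ?Q (Suc n)) = poly_inner (?Q (Suc n)) (?t * ?Q n)"
    by (metis poly_inner_commute poly_inner_mult_left)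
  ultimately have "real (Suc n) / real (2 * n + 1) * poly_inner (?Q (Suc n)) (?Q (Suc n)) =
      real (Suc n) / real (2 * n + 1) * (1 / real (2 * Suc n + 1))"
    unfolding Suc.IH by (simp add: ac_simps)
  then show ?case by (subst (asm) mult_cancel_left) simp
qed

lemma shifted_legendre_functional_sums:
  fixes L :: "real poly \<Rightarrow> real"
  assumes L_add: "\<And>p r. L (p + r) = L p + L r" and L_smult: "\<And>c p. L (smult c p) = c * L p"
  shows "(\<lambda>n. real (2 * n + 1) * L (shifted_legendre n) * poly_inner (shifted_legendre n) p)
    sums L p"
proof (induction p rule: shifted_legendre_induct)
  case (add p r)
  then show ?case using sums_add by (fastforce simp: poly_inner_add_right L_add distrib_left)
next
  case (smult c p)
  then show ?case using sums_mult[of _ "L p" c]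
    by (simp add: poly_inner_smult_right L_smult mult.left_commute)
next
  case (shifted_legendre k)
  have "real (2 * n + 1) * L (shifted_legendre n)
      * poly_inner (shifted_legendre n) (shifted_legendre k) =
      (if n = k then L (shifted_legendre n) else 0)" for n
    by (simp add: poly_inner_shifted_legendre_neq poly_inner_shifted_legendre_same del: of_nat_add)
  then show ?case using sums_single[of k "\<lambda>n. L (shifted_legendre n)"] by simp
qed

lemma shifted_legendre_even_bound:
  assumes "x \<in> {0..1}"
  shows "\<bar>x * (1 - x) * poly (shifted_legendre (2 * m)) x\<bar> \<le> ncbinom m"
proof -
  define t where "t = 2 * x - 1"
  have "\<bar>t\<bar> \<le> 1" using assms by (simp add: t_def abs_le_iff)
  then have "\<bar>(1 - t\<^sup>2) * poly (legendre (2 * m)) t\<bar> \<le> ncbinom m"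
    by (rule legendre_even_bound)
  moreover have "x * (1 - x) = (1 - t\<^sup>2) / 4" by (simp add: t_def power2_eq_square field_simps)
  then have "x * (1 - x) * poly (shifted_legendre (2 * m)) x =
      (1 - t\<^sup>2) * poly (legendre (2 * m)) t / 4"
    unfolding poly_shifted_legendre t_def[symmetric] by (simp only: times_divide_eq_left)
  ultimately show ?thesis by linarith
qed

section \<open>Series of integrals and moments\<close>

lemma has_integral_iff_sums_nonneg:
  fixes f :: "nat \<Rightarrow> 'n::euclidean_space \<Rightarrow> real"
  assumes f: "\<And>k. (f k has_integral c k) S" and nonneg: "\<And>k x. x \<in> S \<Longrightarrow> 0 \<le> f k x"
    and g: "\<And>x. x \<in> S \<Longrightarrow> (\<lambda>k. f k x) sums g x"
  shows "(g has_integral s) S \<longleftrightarrow> c sums s"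
proof -
  have partial: "((\<lambda>x. \<Sum>k<n. f k x) has_integral (\<Sum>k<n. c k)) S" for n
    by (intro has_integral_sum f) simp
  have g_integral: "(g has_integral s) S" if "c sums s" for s
  proof (rule has_integral_monotone_convergence_increasing[OF partial])
    show "(\<Sum>k<n. f k x) \<le> (\<Sum>k<Suc n. f k x)" if "x \<in> S" for n x
      using nonneg[OF that, of n] by simp
    show "(\<lambda>n. \<Sum>k<n. f k x) \<longlonglongrightarrow> g x" if "x \<in> S" for x
      using g[OF that] by (simp add: sums_def)
    show "(\<lambda>n. \<Sum>k<n. c k) \<longlonglongrightarrow> s" using that by (simp add: sums_def)
  qed
  have c_sums: "c sums s" if s: "(g has_integral s) S"
  proof -
    have "(\<Sum>k<n. c k) \<le> s" for n
    proof (rule has_integral_le[OF partial s])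
      show "(\<Sum>k<n. f k x) \<le> g x" if "x \<in> S" for x
        using sum_le_suminf[of "\<lambda>k. f k x" "{..<n}"] g[OF that] nonneg[OF that]
        by (auto simp: sums_iff)
    qed
    then have "(\<Sum>k\<le>n. c k) \<le> s" for n by (metis lessThan_Suc_atMost)
    moreover have "c k \<ge> 0" for k using has_integral_nonneg[OF f nonneg] by blast
    ultimately have "c sums suminf c" by (intro summable_sums bounded_imp_summable[of c s])
    then show ?thesis using has_integral_unique[OF g_integral s] by simp
  qed
  show ?thesis using g_integral c_sums by blast
qed

lemma continuous_on_suminf_M_test:
  fixes f :: "nat \<Rightarrow> 'a::topological_space \<Rightarrow> 'b::banach"
  assumes "\<And>n. continuous_on A (f n)" "\<And>n x. x \<in> A \<Longrightarrow> norm (f n x) \<le> C n" "summable C"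
  shows "continuous_on A (\<lambda>x. \<Sum>n. f n x)"
proof (rule uniform_limit_theorem)
  show "uniform_limit A (\<lambda>n x. \<Sum>i<n. f i x) (\<lambda>x. \<Sum>n. f n x) sequentially"
    by (rule Weierstrass_m_test[OF assms(2,3)])
  show "\<forall>\<^sub>F n in sequentially. continuous_on A (\<lambda>x. \<Sum>i<n. f i x)"
    by (intro always_eventually allI continuous_on_sum assms(1))
qed simp

lemma sums_integral_M_test:
  fixes f :: "nat \<Rightarrow> real \<Rightarrow> 'b::banach"
  assumes "\<And>n. continuous_on {a..b} (f n)" "\<And>n x. x \<in> {a..b} \<Longrightarrow> norm (f n x) \<le> C n" "summable C"
  shows "(\<lambda>n. integral {a..b} (f n)) sums integral {a..b} (\<lambda>x. \<Sum>n. f n x)"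
proof -
  have "uniform_limit {a..b} (\<lambda>n x. \<Sum>i<n. f i x) (\<lambda>x. \<Sum>n. f n x) sequentially"
    by (rule Weierstrass_m_test[OF assms(2,3)])
  moreover have "continuous_on {a..b} (\<lambda>x. \<Sum>i<n. f i x)" for n
    by (intro continuous_on_sum assms(1))
  ultimately obtain I J where I: "\<And>n. ((\<lambda>x. \<Sum>i<n. f i x) has_integral I n) {a..b}"
    and J: "((\<lambda>x. \<Sum>n. f n x) has_integral J) {a..b}" "I \<longlonglongrightarrow> J"
    by (rule uniform_limit_integral[OF _ _ sequentially_bot]) blast
  have "I n = (\<Sum>i<n. integral {a..b} (f i))" for n
    using I[of n] by (subst integral_sum[symmetric])
      (auto simp: integral_unique intro: integrable_continuous_interval assms(1))
  then have "I = (\<lambda>n. \<Sum>i<n. integral {a..b} (f i))" by (rule ext)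
  then show ?thesis using J by (simp add: sums_def integral_unique)
qed

lemma continuous_on_moments_eq_0_imp_eq_0:
  fixes g :: "real \<Rightarrow> real"
  assumes "a < b" and g: "continuous_on {a..b} g"
    and moments: "\<And>p. integral {a..b} (\<lambda>x. poly p x * g x) = 0" and x: "x \<in> {a..b}"
  shows "g x = 0"
proof -
  obtain f where f: "uniform_limit {a..b} f g sequentially" "\<And>n. polynomial_function (f n)"
    using Stone_Weierstrass_uniform_limit[of "{a..b}" g] g by auto
  have "uniform_limit {a..b} (\<lambda>n x. f n x * g x) (\<lambda>x. g x * g x) sequentially"
    by (intro uniform_lim_mult f uniform_limit_const)
       (simp_all add: compact_imp_bounded compact_continuous_image g)
  moreover have "continuous_on {a..b} (\<lambda>x. f n x * g x)" for n
    by (intro continuous_intros g continuous_on_polymonial_function f)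
  ultimately obtain I J where I: "\<And>n. ((\<lambda>x. f n x * g x) has_integral I n) {a..b}"
    and J: "((\<lambda>x. g x * g x) has_integral J) {a..b}" "I \<longlonglongrightarrow> J"
    by (rule uniform_limit_integral[OF _ _ sequentially_bot]) blast
  have "I n = 0" for n
  proof -
    obtain c d where "f n = (\<lambda>x. \<Sum>i\<le>d. c i * x ^ i)"
      using f(2)[of n]
      unfolding real_polynomial_function_eq[symmetric] real_polynomial_function_iff_sum
      by blast
    then have "f n = poly (\<Sum>i\<le>d. monom (c i) i)" by (simp add: fun_eq_iff poly_sum poly_monom)
    then show ?thesis using I[of n] moments by (metis integral_unique)
  qed
  then have "J = 0" using J(2) LIMSEQ_unique[OF _ tendsto_const] by (metis LIMSEQ_const_iff ext)
  moreover have "continuous_on (cbox a b) (\<lambda>x. g x * g x)" using g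
    by (simp add: continuous_intros)
  ultimately have "g x * g x = 0"
    using J(1) x \<open>a < b\<close> by (intro has_integral_0_cbox_imp_0[of a b "\<lambda>x. g x * g x"]) auto
  then show ?thesis by simp
qed

lemma sums_if_moments_sums:
  fixes f :: "nat \<Rightarrow> real \<Rightarrow> real"
  assumes "a < b" and f: "\<And>n. continuous_on {a..b} (f n)" and g: "continuous_on {a..b} g"
    and f_le: "\<And>n x. x \<in> {a..b} \<Longrightarrow> norm (f n x) \<le> C n" and C: "summable C"
    and moments: "\<And>p. (\<lambda>n. integral {a..b} (\<lambda>x. poly p x * f n x)) sums
      integral {a..b} (\<lambda>x. poly p x * g x)"
    and x: "x \<in> {a..b}"
  shows "(\<lambda>n. f n x) sums g x"
proof -
  define S where "S x = (\<Sum>n. f n x)" for x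
  have S: "(\<lambda>n. f n x) sums S x" if "x \<in> {a..b}" for x
    unfolding S_def using f_le[OF that] by (intro summable_sums summable_comparison_test'[OF C])
  have S_cont: "continuous_on {a..b} S"
    unfolding S_def by (rule continuous_on_suminf_M_test[OF f f_le C])
  have "S x - g x = 0"
  proof (rule continuous_on_moments_eq_0_imp_eq_0[OF \<open>a < b\<close> _ _ x])
    show "continuous_on {a..b} (\<lambda>x. S x - g x)" by (intro continuous_intros S_cont g)
    fix p :: "real poly"
    have "bounded (poly p ` {a..b})"
      by (intro compact_imp_bounded compact_continuous_image continuous_intros) simp
    then obtain K where K: "\<forall>x\<in>{a..b}. norm (poly p x) \<le> K" by (auto simp: bounded_iff)
    have "(\<lambda>n. integral {a..b} (\<lambda>x. poly p x * f n x)) sums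
        integral {a..b} (\<lambda>x. \<Sum>n. poly p x * f n x)"
    proof (rule sums_integral_M_test)
      show "norm (poly p x * f n x) \<le> K * C n" if "x \<in> {a..b}" for n x
        unfolding norm_mult using K f_le[OF that] that by (intro mult_mono') auto
    qed (intro continuous_intros f summable_mult C)+
    also have "integral {a..b} (\<lambda>x. \<Sum>n. poly p x * f n x) = integral {a..b} (\<lambda>x. poly p x * S x)"
      by (intro integral_cong sums_unique[symmetric] sums_mult S)
    finally have "integral {a..b} (\<lambda>x. poly p x * S x) = integral {a..b} (\<lambda>x. poly p x * g x)"
      using moments sums_unique2 by blast
    moreover have "integral {a..b} (\<lambda>x. poly p x * (S x - g x)) =
        integral {a..b} (\<lambda>x. poly p x * S x) - integral {a..b} (\<lambda>x. poly p x * g x)"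
      unfolding right_diff_distrib
      by (intro integral_diff integrable_continuous_interval continuous_intros S_cont g)
    ultimately show "integral {a..b} (\<lambda>x. poly p x * (S x - g x)) = 0" by simp
  qed
  then show ?thesis using S[OF x] by simp
qed

section \<open>The quotient of Gamma functions at distance one half\<close>

definition Gamma_half_quotient :: "'a::Gamma \<Rightarrow> 'a" where
  "Gamma_half_quotient z = Gamma z * rGamma (z + 1/2)"

lemma Gamma_half_quotient_of_real:
  "Gamma_half_quotient (complex_of_real x) = of_real (Gamma_half_quotient x)"
proof -
  have "complex_of_real x + 1/2 = of_real (x + 1/2)" by simp
  then show ?thesis
    by (simp only: Gamma_half_quotient_def Gamma_complex_of_real rGamma_complex_of_real
        of_real_mult)
qed

lemma Gamma_half_quotient_plus1:
  assumes "z \<notin> \<int>\<^sub>\<le>\<^sub>0"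
  shows "(z + 1/2) * Gamma_half_quotient (z + 1) = z * Gamma_half_quotient z"
proof -
  have "(z + 1/2) * Gamma_half_quotient (z + 1) =
      Gamma (z + 1) * ((z + 1/2) * rGamma (z + 1/2 + 1))"
    by (simp add: Gamma_half_quotient_def ac_simps)
  then show ?thesis
    unfolding rGamma_plus1 Gamma_plus1[OF assms] by (simp add: Gamma_half_quotient_def ac_simps)
qed

lemma not_nonpos_Ints_real: "0 < x \<Longrightarrow> x \<notin> (\<int>\<^sub>\<le>\<^sub>0 :: real set)"
  by (auto elim!: nonpos_Ints_cases)

lemma Gamma_half_quotient_pos: "0 < x \<Longrightarrow> 0 < Gamma_half_quotient (x :: real)"
  by (simp add: Gamma_half_quotient_def rGamma_inverse_Gamma)

lemma norm_pochhammer_half_quotient_le: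
  assumes "0 < Re z"
  shows "norm (pochhammer (z + 1/2) n / pochhammer z n) \<le>
    pochhammer (Re z + 1/2) n / pochhammer (Re z) n"
proof (induction n)
  case (Suc n)
  define w where "w = z + of_nat n"
  have w: "0 < Re w" "Re w = Re z + real n" using assms by (simp_all add: w_def)
  then have "w \<noteq> 0" by auto
  have "norm ((w + 1/2) / w) = norm (1 + 1 / (2 * w))"
    using \<open>w \<noteq> 0\<close> by (simp add: field_simps)
  also have "\<dots> \<le> 1 + 1 / (2 * norm w)"
    by (rule order_trans[OF norm_triangle_ineq]) (simp add: norm_divide norm_mult)
  also have "\<dots> \<le> 1 + 1 / (2 * Re w)"
    using w(1) complex_Re_le_cmod[of w] by (intro add_left_mono frac_le) auto
  also have "\<dots> = (Re w + 1/2) / Re w" using w by (simp add: field_simps)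
  finally have "norm ((w + 1/2) / w) \<le> (Re w + 1/2) / Re w" .
  then have "norm (pochhammer (z + 1/2) n / pochhammer z n) * norm ((w + 1/2) / w) \<le>
      pochhammer (Re z + 1/2) n / pochhammer (Re z) n * ((Re w + 1/2) / Re w)"
    using Suc.IH by (intro mult_mono') auto
  then show ?case
    by (simp add: pochhammer_Suc norm_mult norm_divide w(2) w_def add_ac)
qed simp

definition Gamma_half_quotient_series :: "'a::Gamma \<Rightarrow> nat \<Rightarrow> 'a" where
  "Gamma_half_quotient_series z n =
     pochhammer (z + 1/2) (Suc n) / pochhammer z (Suc n) * of_real (exp (- ln (real n) / 2))"

lemma Gamma_half_quotient_series_LIMSEQ:
  "Gamma_half_quotient_series z \<longlonglongrightarrow> Gamma_half_quotient z"
proof -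
  have "Gamma_series z n * rGamma_series (z + 1/2) n = Gamma_half_quotient_series z n" for n
  proof -
    define e where "e = exp (z * of_real (ln (real n)))"
    define h :: real where "h = exp (ln (real n) / 2)"
    have "e \<noteq> 0" by (simp add: e_def)
    have "exp ((z + 1/2) * of_real (ln (real n))) = e * of_real h"
      by (simp add: e_def h_def distrib_right exp_add flip: exp_of_real)
    then show ?thesis
      unfolding Gamma_series_def rGamma_series_def Gamma_half_quotient_series_def
      using \<open>e \<noteq> 0\<close> by (simp add: exp_minus field_simps flip: e_def h_def)
  qed
  then show ?thesis
    unfolding Gamma_half_quotient_def
    using tendsto_mult[OF Gamma_series_LIMSEQ[of z] rGamma_series_LIMSEQ[of "z + 1/2"]] by simp
qed

lemma norm_Gamma_half_quotient_le_Re: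
  assumes "0 < Re z"
  shows "norm (Gamma_half_quotient z) \<le> Gamma_half_quotient (Re z)"
proof (rule LIMSEQ_le)
  show "(\<lambda>n. norm (Gamma_half_quotient_series z n)) \<longlonglongrightarrow> norm (Gamma_half_quotient z)"
    by (intro tendsto_norm Gamma_half_quotient_series_LIMSEQ)
  show "Gamma_half_quotient_series (Re z) \<longlonglongrightarrow> Gamma_half_quotient (Re z)"
    by (rule Gamma_half_quotient_series_LIMSEQ)
  have "norm (Gamma_half_quotient_series z n) \<le> Gamma_half_quotient_series (Re z) n" for n
    using norm_pochhammer_half_quotient_le[OF assms, of "Suc n"]
    unfolding Gamma_half_quotient_series_def norm_mult by (intro mult_mono') simp_all
  then show "\<exists>N. \<forall>n\<ge>N. norm (Gamma_half_quotient_series z n) \<le>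
      Gamma_half_quotient_series (Re z) n"
    by blast
qed

lemma Gamma_half_quotient_square_le:
  fixes x :: real
  assumes "1/2 < x"
  shows "(Gamma_half_quotient x)\<^sup>2 \<le> 1 / (x - 1/2)"
proof -
  define y where "y = x - 1/2"
  have y: "0 < y" "x = y + 1/2" "x + 1/2 = y + 1" using assms by (simp_all add: y_def)
  have pos: "0 < Gamma y" "0 < Gamma x" "0 < Gamma (x + 1/2)" using assms by (auto simp: y_def)
  have "(1 - 1/2) *\<^sub>R y + (1/2) *\<^sub>R (x + 1/2) = x" by (simp add: y_def field_simps)
  then have "ln (Gamma x) \<le> (1 - 1/2) * ln (Gamma y) + 1/2 * ln (Gamma (x + 1/2))"
    using convex_onD[OF log_convex_Gamma_real, of "1/2" y "x + 1/2"] y(1) assms by simp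
  then have "ln ((Gamma x)\<^sup>2) \<le> ln (Gamma y * Gamma (x + 1/2))"
    using pos by (simp add: ln_mult ln_realpow)
  then have "(Gamma x)\<^sup>2 \<le> Gamma y * Gamma (x + 1/2)" using pos by (simp add: ln_le_cancel_iff)
  also have "\<dots> = (Gamma (x + 1/2))\<^sup>2 / y"
    unfolding y(3) Gamma_plus1[OF not_nonpos_Ints_real[OF y(1)]]
    using y(1) by (simp add: power2_eq_square)
  finally have "(Gamma x)\<^sup>2 / (Gamma (x + 1/2))\<^sup>2 \<le> (Gamma (x + 1/2))\<^sup>2 / y / (Gamma (x + 1/2))\<^sup>2"
    by (rule divide_right_mono) simp
  then show ?thesis
    unfolding Gamma_half_quotient_def rGamma_inverse_Gamma divide_inverse[symmetric] power_divide
    using pos(3) by (simp add: y_def)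
qed

lemma norm_Gamma_half_quotient_le:
  assumes "1/2 < Re z"
  shows "norm (Gamma_half_quotient z) \<le> 1 / sqrt (Re z - 1/2)"
proof -
  have "norm (Gamma_half_quotient z) \<le> Gamma_half_quotient (Re z)"
    using assms by (intro norm_Gamma_half_quotient_le_Re) simp
  also have "\<dots> \<le> sqrt (1 / (Re z - 1/2))"
    using Gamma_half_quotient_square_le[OF assms] by (rule real_le_rsqrt)
  finally show ?thesis by (simp add: real_sqrt_divide)
qed

lemma Gamma_term_eq:
  "Gamma_term \<nu> m = of_real (ncbinom m ^ 3 * (-1) ^ (m + 1) * (4 * real m + 1)) *
     (Gamma_half_quotient (of_nat m - \<nu>) * Gamma_half_quotient (of_nat m + \<nu> + 1))"
proof -
  have "c * s * (g * h * n / (g' * h')) = c * s * n * (g * inverse g' * (h * inverse h'))"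
    for c s n g g' h h' :: complex
    by (simp add: divide_inverse)
  moreover have "of_nat m + \<nu> + 1 + 1/2 = of_nat m + \<nu> + 3/2" by simp
  moreover have "of_real (ncbinom m ^ 3 * (-1) ^ (m + 1) * (4 * real m + 1)) =
      complex_of_real (ncbinom m) ^ 3 * (-1) ^ (m + 1) * (4 * of_nat m + 1)"
    by simp
  ultimately show ?thesis
    unfolding Gamma_term_def Gamma_half_quotient_def rGamma_inverse_Gamma by (simp only:)
qed

lemma eventually_norm_Gamma_term_le:
  "\<forall>\<^sub>F m in sequentially. \<forall>\<nu>. \<bar>Re \<nu>\<bar> \<le> K \<longrightarrow> norm (Gamma_term \<nu> m) \<le> 5 * ncbinom m ^ 3"
proof -
  obtain N :: nat where N: "5 * \<bar>K\<bar> + 4 \<le> real N" using real_arch_simple by blast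
  have "norm (Gamma_term \<nu> m) \<le> 5 * ncbinom m ^ 3" if "N \<le> m" "\<bar>Re \<nu>\<bar> \<le> K" for m \<nu>
  proof -
    define d where "d = real m - K - 1/2"
    have d: "0 < d" "4 * real m + 1 \<le> 5 * d" using N that by (simp_all add: d_def)
    have le: "norm (Gamma_half_quotient z) \<le> 1 / sqrt d" if "d \<le> Re z - 1/2" for z
      by (rule order_trans[OF norm_Gamma_half_quotient_le]) (use that d in \<open>auto simp: frac_le\<close>)
    have "norm (Gamma_half_quotient (of_nat m - \<nu>))
        * norm (Gamma_half_quotient (of_nat m + \<nu> + 1))
        \<le> 1 / sqrt d * (1 / sqrt d)"
      using that(2) by (intro mult_mono' le) (auto simp: d_def)
    also have "\<dots> = 1 / d" using d(1) by simp
    finally have "(4 * real m + 1) * (norm (Gamma_half_quotient (of_nat m - \<nu>))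
        * norm (Gamma_half_quotient (of_nat m + \<nu> + 1))) \<le> 5 * d * (1 / d)"
      using d by (intro mult_mono) auto
    then have "ncbinom m ^ 3 * ((4 * real m + 1) * (norm (Gamma_half_quotient (of_nat m - \<nu>))
        * norm (Gamma_half_quotient (of_nat m + \<nu> + 1)))) \<le> ncbinom m ^ 3 * 5"
      using d(1) by (intro mult_left_mono) auto
    then show ?thesis
      unfolding Gamma_term_eq norm_mult norm_of_real by (simp add: abs_mult power_abs ac_simps)
  qed
  then show ?thesis unfolding eventually_sequentially by blast
qed

lemma summable_norm_Gamma_term: "summable (\<lambda>m. norm (Gamma_term \<nu> m))"
proof (rule summable_comparison_test_ev)
  show "\<forall>\<^sub>F m in sequentially. norm (norm (Gamma_term \<nu> m)) \<le> 5 * ncbinom m ^ 3"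
    using eventually_norm_Gamma_term_le[of "\<bar>Re \<nu>\<bar>"] by eventually_elim simp
qed (intro summable_mult summable_ncbinom_cube)

lemma open_Compl_Ints: "open (- \<int> :: complex set)"
  by (intro open_Compl closed_Ints)

lemma Gamma_term_holomorphic: "(\<lambda>\<nu>. Gamma_term \<nu> m) holomorphic_on - \<int>"
proof -
  have "of_nat m - \<nu> \<notin> \<int>\<^sub>\<le>\<^sub>0" "of_nat m + \<nu> + 1 \<notin> \<int>\<^sub>\<le>\<^sub>0" if "\<nu> \<notin> \<int>" for \<nu> :: complex
  proof -
    have "of_nat m - \<nu> \<notin> \<int>" "of_nat m + \<nu> + 1 \<notin> \<int>"
      using that Ints_diff[of "of_nat m" "of_nat m - \<nu>"]
        Ints_diff[of "of_nat m + \<nu> + 1" "of_nat (m + 1)"]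
      by auto
    then show "of_nat m - \<nu> \<notin> \<int>\<^sub>\<le>\<^sub>0" "of_nat m + \<nu> + 1 \<notin> \<int>\<^sub>\<le>\<^sub>0"
      using nonpos_Ints_subset_Ints by blast+
  qed
  then show ?thesis
    unfolding Gamma_term_eq Gamma_half_quotient_def by (intro holomorphic_intros) auto
qed

lemma suminf_Gamma_term_holomorphic: "(\<lambda>\<nu>. \<Sum>m. Gamma_term \<nu> m) holomorphic_on - \<int>"
proof (rule holomorphic_uniform_sequence[OF open_Compl_Ints])
  show "(\<lambda>\<nu>. \<Sum>m<n. Gamma_term \<nu> m) holomorphic_on - \<int>" for n
    by (intro holomorphic_intros Gamma_term_holomorphic)
  fix z :: complex assume "z \<in> - \<int>"
  then obtain r where r: "r > 0" "cball z r \<subseteq> - \<int>"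
    using open_Compl_Ints open_contains_cball by blast
  have "\<bar>Re \<nu>\<bar> \<le> norm z + r" if "\<nu> \<in> cball z r" for \<nu>
    using that abs_Re_le_cmod[of \<nu>] norm_triangle_ineq2[of \<nu> z]
    by (simp add: dist_norm norm_minus_commute)
  then have "\<forall>\<^sub>F m in sequentially. \<forall>\<nu>\<in>cball z r. norm (Gamma_term \<nu> m) \<le> 5 * ncbinom m ^ 3"
    using eventually_norm_Gamma_term_le[of "norm z + r"] by (auto elim: eventually_mono)
  then have "uniform_limit (cball z r) (\<lambda>n \<nu>. \<Sum>m<n. Gamma_term \<nu> m)
      (\<lambda>\<nu>. \<Sum>m. Gamma_term \<nu> m) sequentially"
    by (rule Weierstrass_m_test_ev) (intro summable_mult summable_ncbinom_cube)
  then show "\<exists>d>0. cball z d \<subseteq> - \<int> \<and> uniform_limit (cball z d) (\<lambda>n \<nu>. \<Sum>m<n. Gamma_term \<nu> m)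
      (\<lambda>\<nu>. \<Sum>m. Gamma_term \<nu> m) sequentially"
    using r by blast
qed

section \<open>Hypergeometric series\<close>

definition hypergeometric_coeff :: "real \<Rightarrow> real \<Rightarrow> real \<Rightarrow> nat \<Rightarrow> real" where
  "hypergeometric_coeff a b c k = pochhammer a k * pochhammer b k / (pochhammer c k * fact k)"

lemma hypergeometric_coeff_Suc:
  "hypergeometric_coeff a b c (Suc k) =
     hypergeometric_coeff a b c k * ((a + real k) * (b + real k) / ((c + real k) * (real k + 1)))"
  by (simp add: hypergeometric_coeff_def pochhammer_Suc ac_simps)

lemma binomial_series_pochhammer:
  fixes a x :: real
  assumes "\<bar>x\<bar> < 1"
  shows "(\<lambda>k. pochhammer a k / fact k * x ^ k) sums (1 - x) powr (- a)"
proof -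
  have "((- a) gchoose k) * (- x) ^ k = pochhammer a k / fact k * x ^ k" for k
  proof -
    have "((- a) gchoose k) * (- x) ^ k =
        pochhammer a k / fact k * x ^ k * ((- 1) ^ k * (- 1) ^ k)"
      unfolding gbinomial_pochhammer power_minus[of x k] by simp
    also have "(- 1) ^ k * (- 1) ^ k = (1::real)" by (simp flip: power_mult_distrib)
    finally show ?thesis by simp
  qed
  then show ?thesis using gen_binomial_real[of "- x" "- a"] assms by simp
qed

lemma Gamma_plus_of_nat_real: "0 < x \<Longrightarrow> Gamma (x + real k) = pochhammer x k * Gamma x"
  by (simp add: pochhammer_Gamma not_nonpos_Ints_real less_imp_neq[OF Gamma_real_pos, symmetric])

lemma Beta_plus_of_nat_left_real:
  assumes "0 < x" "0 < y"
  shows "Beta (x + real k) y = pochhammer x k / pochhammer (x + y) k * Beta x y"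
  using assms Gamma_plus_of_nat_real[of x k] Gamma_plus_of_nat_real[of "x + y" k]
  by (simp add: Beta_def add.commute add.left_commute)

lemma has_integral_Beta_real_Ioo:
  assumes "0 < (a::real)" "0 < b"
  shows "((\<lambda>t. t powr (a - 1) * (1 - t) powr (b - 1)) has_integral Beta a b) {0<..<1}"
  using has_integral_Beta_real[OF assms] by (simp add: has_integral_Icc_iff_Ioo)

text \<open>Euler's integral representation, stated so that the endpoint \<open>x = 1\<close> is included.\<close>
lemma hypergeometric_sums_iff_Euler_integral:
  assumes "0 < a" "0 < b" "b < c" "0 \<le> x" "x \<le> 1"
  shows "((\<lambda>s. s powr (b - 1) * (1 - s) powr (c - b - 1) * (1 - x * s) powr (- a))
      has_integral Beta b (c - b) * F) {0<..<1} \<longleftrightarrow>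
    (\<lambda>k. hypergeometric_coeff a b c k * x ^ k) sums F"
proof -
  let ?f = "\<lambda>k s. pochhammer a k / fact k * x ^ k
      * (s powr (b + real k - 1) * (1 - s) powr (c - b - 1))"
  have "(?f k has_integral Beta b (c - b) * (hypergeometric_coeff a b c k * x ^ k)) {0<..<1}"
      for k
  proof -
    have "(?f k has_integral pochhammer a k / fact k * x ^ k
        * Beta (b + real k) (c - b)) {0<..<1}"
      using assms by (intro has_integral_mult_right has_integral_Beta_real_Ioo) auto
    then show ?thesis
      using assms Beta_plus_of_nat_left_real[of b "c - b" k]
      by (simp add: hypergeometric_coeff_def ac_simps)
  qed
  moreover have "(\<lambda>k. ?f k s) sums
      (s powr (b - 1) * (1 - s) powr (c - b - 1) * (1 - x * s) powr (- a))"
    if "s \<in> {0<..<1}" for s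
  proof -
    have "x * s \<le> s" using assms that by (intro mult_left_le_one_le) auto
    then have "x * s < 1" by (rule order_le_less_trans) (use that in simp)
    then have "\<bar>x * s\<bar> < 1" using assms that by simp
    then have "(\<lambda>k. s powr (b - 1) * (1 - s) powr (c - b - 1) *
        (pochhammer a k / fact k * (x * s) ^ k)) sums
        (s powr (b - 1) * (1 - s) powr (c - b - 1) * (1 - x * s) powr (- a))"
      by (intro sums_mult binomial_series_pochhammer)
    moreover have "s powr (b + real k - 1) = s powr (b - 1) * s ^ k" for k
      using that powr_add[of s "b - 1" "real k"] by (simp add: powr_realpow algebra_simps)
    ultimately show ?thesis by (simp add: power_mult_distrib ac_simps)
  qed
  ultimately have "((\<lambda>s. s powr (b - 1) * (1 - s) powr (c - b - 1) * (1 - x * s) powr (- a))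
      has_integral Beta b (c - b) * F) {0<..<1} \<longleftrightarrow>
      (\<lambda>k. Beta b (c - b) * (hypergeometric_coeff a b c k * x ^ k)) sums (Beta b (c - b) * F)"
    using assms by (intro has_integral_iff_sums_nonneg[where f = ?f])
        (auto simp: pochhammer_nonneg)
  moreover have "Beta b (c - b) \<noteq> 0"
    using assms by (simp add: Beta_def less_imp_neq[OF Gamma_real_pos, symmetric])
  ultimately show ?thesis by (simp add: sums_mult_iff)
qed

theorem Gauss_hypergeometric_sums:
  assumes "0 < a" "0 < b" "a + b < c"
  shows "hypergeometric_coeff a b c sums
    (Gamma c * Gamma (c - a - b) / (Gamma (c - a) * Gamma (c - b)))"
proof -
  let ?F = "Gamma c * Gamma (c - a - b) / (Gamma (c - a) * Gamma (c - b))"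
  have "((\<lambda>s. s powr (b - 1) * (1 - s) powr (c - a - b - 1)) has_integral
      Beta b (c - a - b)) {0<..<1}"
    using assms by (intro has_integral_Beta_real_Ioo) auto
  then have "((\<lambda>s. s powr (b - 1) * (1 - s) powr (c - b - 1) * (1 - 1 * s) powr (- a))
      has_integral Beta b (c - a - b)) {0<..<1}"
    by (rule has_integral_eq[rotated]) (simp add: mult.assoc algebra_simps flip: powr_add)
  also have "Beta b (c - a - b) = Beta b (c - b) * ?F"
  proof -
    have "Gamma c \<noteq> 0" "Gamma (c - b) \<noteq> 0"
      using assms by (simp_all add: less_imp_neq[OF Gamma_real_pos, symmetric])
    then show ?thesis by (simp add: Beta_def algebra_simps)
  qed
  finally show ?thesis
    using hypergeometric_sums_iff_Euler_integral[of a b c 1 ?F] assms by simp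
qed

lemma has_integral_substitution_one_minus_square:
  fixes f :: "real \<Rightarrow> real"
  assumes f: "(f has_integral I) {0<..<1}" and nonneg: "\<And>y. y \<in> {0<..<1} \<Longrightarrow> 0 \<le> f y"
  shows "((\<lambda>s. 2 * (1 - s) * f ((1 - s)\<^sup>2)) has_integral I) {0<..<1}"
proof -
  define g where "g s = (1 - s)\<^sup>2" for s :: real
  define g' where "g' s = - 2 * (1 - s)" for s :: real
  have image: "g ` {0<..<1} = {0<..<1}"
  proof
    show "g ` {0<..<1} \<subseteq> {0<..<1}" by (auto simp: g_def abs_square_less_1)
    have "y = g (1 - sqrt y)" "1 - sqrt y \<in> {0<..<1}" if "y \<in> {0<..<1}" for y
      using that by (simp_all add: g_def)
    then show "{0<..<1} \<subseteq> g ` {0<..<1}" by blast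
  qed
  have inj: "inj_on g {0<..<1}"
    by (auto simp: inj_on_def g_def power2_eq_iff_nonneg)
  have deriv: "(g has_field_derivative g' s) (at s within {0<..<1})" for s
    unfolding g_def g'_def by (auto intro!: derivative_eq_intros)
  have "f absolutely_integrable_on {0<..<1}"
    using f nonneg by (intro nonnegative_absolutely_integrable_1) (auto simp: integrable_on_def)
  with f have "(\<lambda>s. \<bar>g' s\<bar> * f (g s)) absolutely_integrable_on {0<..<1} \<and>
      integral {0<..<1} (\<lambda>s. \<bar>g' s\<bar> * f (g s)) = I"
    using has_absolute_integral_change_of_variables_1'[OF _ deriv inj]
    by (simp add: image integral_unique)
  then have "((\<lambda>s. \<bar>g' s\<bar> * f (g s)) has_integral I) {0<..<1}"
    using set_lebesgue_integral_eq_integral(1) integrable_integral by metis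
  then show ?thesis by (rule has_integral_eq[rotated]) (simp add: g_def g'_def)
qed

text \<open>Under the substitution \<open>y = (1 - s)\<^sup>2\<close> the factor \<open>2 s (1 - s/2)\<close> becomes \<open>1 - y\<close>.\<close>
lemma has_integral_Euler_midpoint:
  fixes a b :: real
  assumes "a < 1" "0 < b"
  shows "((\<lambda>s. s powr (- a) * (1 - s) powr (b - 1) * (1 - 1/2 * s) powr (- a))
    has_integral 2 powr (a - 1) * Beta (b / 2) (1 - a)) {0<..<1}"
proof -
  define f where "f y = y powr (b / 2 - 1) * (1 - y) powr (- a)" for y :: real
  have "(f has_integral Beta (b / 2) (1 - a)) {0<..<1}"
    unfolding f_def using has_integral_Beta_real_Ioo[of "b / 2" "1 - a"] assms by simp
  then have "((\<lambda>s. 2 powr (a - 1) * (2 * (1 - s) * f ((1 - s)\<^sup>2))) has_integral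
      2 powr (a - 1) * Beta (b / 2) (1 - a)) {0<..<1}"
    by (intro has_integral_mult_right has_integral_substitution_one_minus_square)
       (assumption, simp add: f_def)
  then show ?thesis
  proof (rule has_integral_eq[rotated])
    fix s :: real assume "s \<in> {0<..<1}"
    then have s: "0 < s" "s < 1" by auto
    have "1 - (1 - s)\<^sup>2 = 2 * (s * (1 - 1/2 * s))"
      by (simp add: power2_eq_square algebra_simps)
    moreover have "((1 - s)\<^sup>2) powr (b / 2 - 1) = (1 - s) powr (b - 2)"
      using s powr_powr[of "1 - s" 2 "b / 2 - 1"] by (simp add: algebra_simps)
    ultimately have "f ((1 - s)\<^sup>2) =
        (1 - s) powr (b - 2) * (2 powr (- a) * (s powr (- a) * (1 - 1/2 * s) powr (- a)))"
      using s by (simp add: f_def powr_mult)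
    then have "2 powr (a - 1) * (2 * (1 - s) * f ((1 - s)\<^sup>2)) =
        (2 powr (a - 1) * 2 * 2 powr (- a)) * ((1 - s) * (1 - s) powr (b - 2)) *
        (s powr (- a) * (1 - 1/2 * s) powr (- a))"
      by simp
    also have "2 powr (a - 1) * 2 * 2 powr (- a) = (1::real)"
      by (simp add: powr_diff powr_minus)
    also have "(1 - s) * (1 - s) powr (b - 2) = (1 - s) powr (b - 1)"
      using s by (simp add: powr_diff power2_eq_square)
    finally show "2 powr (a - 1) * (2 * (1 - s) * f ((1 - s)\<^sup>2)) =
        s powr (- a) * (1 - s) powr (b - 1) * (1 - 1/2 * s) powr (- a)"
      by (simp add: ac_simps)
  qed
qed

lemma rGamma_reflection_real: "rGamma x * rGamma (1 - x) = sin (pi * x) / (pi::real)"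
proof -
  have "complex_of_real (rGamma x * rGamma (1 - x)) = complex_of_real (sin (pi * x) / pi)"
    using rGamma_reflection_complex[of "of_real x"]
    by (simp add: rGamma_complex_of_real[symmetric] sin_of_real[symmetric])
  then show ?thesis by (simp only: of_real_eq_iff)
qed

lemma Gamma_reflection_real: "Gamma x * Gamma (1 - x) = pi / sin (pi * x :: real)"
  using arg_cong[OF rGamma_reflection_real[of x], of inverse]
  by (simp add: rGamma_inverse_Gamma)

lemma Gamma_legendre_duplication_real:
  assumes "0 < (x::real)"
  shows "Gamma x * Gamma (x + 1/2) = 2 powr (1 - 2 * x) * sqrt pi * Gamma (2 * x)"
proof -
  have "complex_of_real x \<notin> \<int>\<^sub>\<le>\<^sub>0" "complex_of_real (x + 1/2) \<notin> \<int>\<^sub>\<le>\<^sub>0"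
    unfolding of_real_in_nonpos_Ints_iff using assms by (simp_all add: not_nonpos_Ints_real)
  moreover have "complex_of_real (x + 1/2) = of_real x + 1/2" by simp
  ultimately have "complex_of_real (Gamma x * Gamma (x + 1/2)) =
      of_real (exp ((1 - 2 * x) * ln 2) * sqrt pi * Gamma (2 * x))"
    using Gamma_legendre_duplication[of "complex_of_real x"]
    by (simp add: Gamma_complex_of_real[symmetric] exp_of_real[symmetric])
  then show ?thesis by (simp only: of_real_eq_iff powr_def) simp
qed

lemma hypergeometric_midpoint_sums:
  assumes "0 < a" "a < 1"
  shows "(\<lambda>k. hypergeometric_coeff a (1 - a) 1 k * (1/2) ^ k) sums
    (sqrt pi / (Gamma ((1 + a) / 2) * Gamma (1 - a / 2)))"
proof -
  have pos: "0 < Gamma a" "0 < Gamma (1 - a)" "0 < Gamma ((1 + a) / 2)" "0 < Gamma (1 - a / 2)"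
    using assms by auto
  have "Gamma (a / 2) * Gamma ((1 + a) / 2) = 2 powr (1 - a) * sqrt pi * Gamma a"
    using Gamma_legendre_duplication_real[of "a / 2"] assms
    by (simp add: add_divide_distrib add.commute)
  then have duplication: "2 powr (a - 1) * Gamma (a / 2) =
      sqrt pi * Gamma a / Gamma ((1 + a) / 2)"
    using pos by (simp add: powr_diff field_simps)
  have "2 powr (a - 1) * Beta (a / 2) (1 - a) =
      2 powr (a - 1) * Gamma (a / 2) * Gamma (1 - a) / Gamma (1 - a / 2)"
    by (simp add: Beta_def algebra_simps)
  also have "\<dots> = Gamma (1 - a) * Gamma a * (sqrt pi / (Gamma ((1 + a) / 2) * Gamma (1 - a / 2)))"
    unfolding duplication by (simp add: ac_simps)
  also have "Gamma (1 - a) * Gamma a = Beta (1 - a) (1 - (1 - a))"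
    by (simp add: Beta_def)
  finally have "((\<lambda>s. s powr (- a) * (1 - s) powr (a - 1) * (1 - 1/2 * s) powr (- a)) has_integral
      Beta (1 - a) (1 - (1 - a)) * (sqrt pi / (Gamma ((1 + a) / 2) * Gamma (1 - a / 2)))) {0<..<1}"
    using has_integral_Euler_midpoint[of a a] assms by (simp only:)
  then show ?thesis
    using hypergeometric_sums_iff_Euler_integral[of a "1 - a" 1 "1/2"
      "sqrt pi / (Gamma ((1 + a) / 2) * Gamma (1 - a / 2))"] assms by simp
qed

lemma Gamma_half_quotient_mult_reflected:
  "(1/2 - a) * (Gamma_half_quotient a * Gamma_half_quotient (1 - a)) = cot (pi * a :: real)"
proof -
  have shift: "(1/2 - a) * rGamma (1 - a + 1/2) = rGamma (1/2 - a)"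
    using rGamma_plus1[of "1/2 - a"] by (simp add: algebra_simps)
  have "rGamma (a + 1/2) * rGamma (1/2 - a) = cos (pi * a) / pi"
    using rGamma_reflection_real[of "a + 1/2"] sin_add[of "pi * a" "pi / 2"]
    by (simp add: algebra_simps)
  then have "rGamma (a + 1/2) * ((1/2 - a) * rGamma (1 - a + 1/2)) = cos (pi * a) / pi"
    unfolding shift .
  then have "Gamma a * Gamma (1 - a) * (rGamma (a + 1/2) * ((1/2 - a) * rGamma (1 - a + 1/2))) =
      pi / sin (pi * a) * (cos (pi * a) / pi)"
    unfolding Gamma_reflection_real by (rule arg_cong)
  then show ?thesis by (simp add: Gamma_half_quotient_def cot_def ac_simps)
qed

lemma Digamma_reflection_real:
  assumes "0 < a" "a < (1::real)"
  shows "Digamma (1 - a) - Digamma a = pi * cot (pi * a)"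
proof -
  have log_reflection: "ln_Gamma x + ln_Gamma (1 - x) = ln pi - ln (sin (pi * x))"
    if "x \<in> {0<..<1}" for x :: real
  proof -
    have "0 < sin (pi * x)" using that by (simp add: sin_gt_zero)
    then have "ln (Gamma x * Gamma (1 - x)) = ln pi - ln (sin (pi * x))"
      unfolding Gamma_reflection_real by (simp add: ln_div)
    moreover have "0 < Gamma x" "0 < Gamma (1 - x)" using that by auto
    ultimately show ?thesis using that by (simp add: ln_Gamma_real_pos ln_mult)
  qed
  have "((\<lambda>x. ln_Gamma x + ln_Gamma (1 - x)) has_field_derivative
      Digamma a - Digamma (1 - a)) (at a)"
    using assms by (auto intro!: derivative_eq_intros)
  then have "((\<lambda>x. ln pi - ln (sin (pi * x))) has_field_derivative
      Digamma a - Digamma (1 - a)) (at a)"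
    by (rule has_field_derivative_transform_within_open[of _ _ _ "{0<..<1}"])
       (use assms log_reflection in auto)
  moreover have "((\<lambda>x. ln pi - ln (sin (pi * x))) has_field_derivative
      - (pi * cot (pi * a))) (at a)"
    using assms sin_gt_zero[of "pi * a"]
    by (auto intro!: derivative_eq_intros simp: cot_def field_simps)
  ultimately show ?thesis using DERIV_unique by fastforce
qed

lemma inverse_diff_sums_Digamma:
  fixes x y :: real
  assumes "x \<noteq> 0" "y \<noteq> 0"
  shows "(\<lambda>k. inverse (x + real k) - inverse (y + real k)) sums (Digamma y - Digamma x)"
  using tendsto_diff[OF Digamma_LIMSEQ[OF assms(2)] Digamma_LIMSEQ[OF assms(1)]]
  by (simp add: sums_def sum_subtractf)

lemma inverse_odd_squares_sums: "(\<lambda>n. 1 / (2 * real n + 1)\<^sup>2) sums (pi\<^sup>2 / 8)"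
proof -
  have "(\<lambda>n. \<Sum>k\<in>{n*2..<n*2+2}. 1 / (real k + 1)\<^sup>2) sums (pi\<^sup>2 / 6)"
    using sums_group[OF inverse_squares_sums, of 2] by (simp add: add.commute)
  moreover have "(\<Sum>k\<in>{n*2..<n*2+2}. 1 / (real k + 1)\<^sup>2) =
      1 / (2 * real n + 1)\<^sup>2 + 1/4 * (1 / (1 + real n)\<^sup>2)" for n
  proof -
    have "{n*2..<n*2+2} = {2*n, 2*n+1}" by auto
    moreover have "(real (2 * n + 1) + 1)\<^sup>2 = 4 * (1 + real n)\<^sup>2"
      by (simp add: power2_eq_square algebra_simps)
    ultimately show ?thesis by simp
  qed
  ultimately have "(\<lambda>n. 1 / (2 * real n + 1)\<^sup>2 + 1/4 * (1 / (1 + real n)\<^sup>2)) sums (pi\<^sup>2 / 6)"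
    by (simp only:)
  from sums_diff[OF this sums_mult[OF inverse_squares_sums, of "1/4"]]
  show ?thesis by (simp add: add.commute)
qed

lemma inverse_quadratic_sums:
  assumes "0 < a" "a < 1"
  shows "(\<lambda>k. 1 / ((real k + a) * (real k + 1 - a))) sums
    (pi / 2 * (Gamma_half_quotient a * Gamma_half_quotient (1 - a)))"
proof (cases "a = 1/2")
  case True
  have "1 / ((real k + a) * (real k + 1 - a)) = 4 * (1 / (2 * real k + 1)\<^sup>2)" for k
    by (simp add: True power2_eq_square divide_simps) (simp add: algebra_simps)
  moreover have "pi / 2 * (Gamma_half_quotient a * Gamma_half_quotient (1 - a)) = 4 * (pi\<^sup>2 / 8)"
    by (simp add: True Gamma_half_quotient_def Gamma_one_half_real power2_eq_square)
  ultimately show ?thesis using sums_mult[OF inverse_odd_squares_sums, of 4] by simp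
next
  case False
  have "(\<lambda>k. 1 / (1 - 2 * a) * (inverse (a + real k) - inverse (1 - a + real k))) sums
      (1 / (1 - 2 * a) * (pi * cot (pi * a)))"
    unfolding Digamma_reflection_real[OF assms, symmetric]
    using assms by (intro sums_mult inverse_diff_sums_Digamma) auto
  moreover have "1 / (1 - 2 * a) * (inverse (a + real k) - inverse (1 - a + real k)) =
      1 / ((real k + a) * (real k + 1 - a))" for k
  proof -
    have "a + real k \<noteq> 0" "1 - a + real k \<noteq> 0" using assms by auto
    then show ?thesis using False by (simp add: field_simps)
  qed
  moreover have "1 / (1 - 2 * a) * (pi * cot (pi * a)) =
      pi / 2 * (Gamma_half_quotient a * Gamma_half_quotient (1 - a))"
    unfolding Gamma_half_quotient_mult_reflected[symmetric] using False by (simp add: field_simps)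
  ultimately show ?thesis by (simp only:)
qed

section \<open>Moments of products of Legendre functions\<close>

lemma has_integral_power_mult_power:
  "((\<lambda>x. x ^ n * (1 - x) ^ k) has_integral Beta (real n + 1) (real k + 1)) {0<..<1::real}"
  using has_integral_Beta_real_Ioo[of "real n + 1" "real k + 1"]
  by (rule has_integral_eq[rotated]) (auto simp: powr_realpow)

locale legendre_function =
  fixes a :: real
  assumes a_pos: "0 < a" and a_less_1: "a < 1"
begin

definition \<kappa> :: real where "\<kappa> = a * (1 - a)"

definition hyp_coeff :: "nat \<Rightarrow> real" where
  "hyp_coeff k = hypergeometric_coeff a (1 - a) 1 k"

definition hyp_moment :: "nat \<Rightarrow> real" where
  "hyp_moment n = (fact n)\<^sup>2 / (Gamma (real n + 1 + a) * Gamma (real n + 2 - a))"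

definition product_moment :: "nat \<Rightarrow> real" where
  "product_moment n = (\<Sum>k. hyp_coeff k * hyp_moment (n + k))"

lemma \<kappa>_pos: "0 < \<kappa>"
  using a_pos a_less_1 by (simp add: \<kappa>_def)

lemma \<kappa>_le_quarter: "\<kappa> \<le> 1/4"
  using zero_le_power2[of "a - 1/2"] by (simp add: \<kappa>_def power2_eq_square algebra_simps)

lemma quadratic_plus_\<kappa>_pos: "0 < (real k)\<^sup>2 + real k + \<kappa>"
  using \<kappa>_pos by (simp add: add_nonneg_pos)

lemma hyp_coeff_0 [simp]: "hyp_coeff 0 = 1"
  by (simp add: hyp_coeff_def hypergeometric_coeff_def)

lemma hyp_coeff_pos: "0 < hyp_coeff k"
  using a_pos a_less_1 by (simp add: hyp_coeff_def hypergeometric_coeff_def pochhammer_pos)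

lemma hyp_coeff_Suc:
  "(real k + 1)\<^sup>2 * hyp_coeff (Suc k) = ((real k)\<^sup>2 + real k + \<kappa>) * hyp_coeff k"
proof -
  have "(a + real k) * (1 - a + real k) = (real k)\<^sup>2 + real k + \<kappa>"
    by (simp add: \<kappa>_def power2_eq_square algebra_simps)
  moreover have "1 + real k \<noteq> 0" by (simp add: add_nonneg_eq_0_iff)
  ultimately show ?thesis
    by (simp add: hyp_coeff_def hypergeometric_coeff_Suc power2_eq_square add.commute[of 1])
qed

lemma hyp_coeff_le: "hyp_coeff k \<le> 1 / (real k + 1)"
proof (induction k)
  case (Suc k)
  define y where "y = real k"
  have y: "0 \<le> y" by (simp add: y_def)
  have "\<kappa> * (y + 2) \<le> 1/4 * (y + 2)" using y by (intro mult_right_mono \<kappa>_le_quarter) simp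
  then have "(y\<^sup>2 + y + \<kappa>) * (y + 2) \<le> (y + 1) ^ 3"
    using y by (simp add: power2_eq_square power3_eq_cube algebra_simps)
  then have "(y\<^sup>2 + y + \<kappa>) * (1 / (y + 1)) \<le> (y + 1)\<^sup>2 * (1 / (y + 2))"
    using y by (simp add: divide_simps) (simp add: power2_eq_square power3_eq_cube algebra_simps)
  moreover have "(y + 1)\<^sup>2 * hyp_coeff (Suc k) \<le> (y\<^sup>2 + y + \<kappa>) * (1 / (y + 1))"
    unfolding y_def hyp_coeff_Suc using quadratic_plus_\<kappa>_pos[of k]
    by (intro mult_left_mono Suc.IH) simp
  ultimately have "(y + 1)\<^sup>2 * hyp_coeff (Suc k) \<le> (y + 1)\<^sup>2 * (1 / (y + 2))" by linarith
  then have "hyp_coeff (Suc k) \<le> 1 / (y + 2)" by (rule mult_left_le_imp_le) (use y in simp)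
  then show ?case by (simp add: y_def add.commute)
qed simp

lemma hyp_coeff_le_1: "hyp_coeff k \<le> 1"
  by (rule order_trans[OF hyp_coeff_le]) simp

lemma hyp_moment_pos: "0 < hyp_moment n"
  using a_pos a_less_1 by (simp add: hyp_moment_def)

text \<open>Gauss's theorem at \<open>c = n + 2\<close>.\<close>
lemma hyp_moment_sums: "(\<lambda>k. hyp_coeff k * Beta (real n + 1) (real k + 1)) sums hyp_moment n"
proof -
  have Gamma_n: "Gamma (real n + 1) = fact n" "Gamma (real n + 2) = (real n + 1) * fact n"
    using Gamma_fact[of n, where 'a = real] Gamma_fact[of "Suc n", where 'a = real]
    by (simp_all add: add_ac)
  have "hyp_coeff k * Beta (real n + 1) (real k + 1) =
      1 / (real n + 1) * hypergeometric_coeff a (1 - a) (real n + 2) k" for k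
  proof -
    have "Beta (real n + 1) (real k + 1) = Beta (1 + real k) (real n + 1)"
      by (metis Beta_commute add.commute)
    also have "\<dots> = fact k / pochhammer (1 + (real n + 1)) k * Beta 1 (real n + 1)"
      by (subst Beta_plus_of_nat_left_real) (simp_all add: pochhammer_fact)
    also have "1 + (real n + 1) = real n + 2" by simp
    also have "Beta 1 (real n + 1) = 1 / (real n + 1)"
      using Gamma_n by (simp add: Beta_def add_ac)
    finally show ?thesis
      by (simp add: hyp_coeff_def hypergeometric_coeff_def pochhammer_fact)
  qed
  moreover have "hypergeometric_coeff a (1 - a) (real n + 2) sums ((real n + 1) * hyp_moment n)"
    using Gauss_hypergeometric_sums[of a "1 - a" "real n + 2"] a_pos a_less_1 Gamma_n
    by (simp add: hyp_moment_def power2_eq_square add_ac mult_ac diff_add_eq)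
  from sums_mult[OF this, of "1 / (real n + 1)"]
  have "(\<lambda>k. 1 / (real n + 1) * hypergeometric_coeff a (1 - a) (real n + 2) k) sums hyp_moment n"
    by (simp add: add_nonneg_eq_0_iff)
  ultimately show ?thesis by (simp only:)
qed

lemma hyp_moment_Suc:
  "((real n + 1)\<^sup>2 + (real n + 1) + \<kappa>) * hyp_moment (Suc n) = (real n + 1)\<^sup>2 * hyp_moment n"
proof -
  define x y where "x = real n + 1 + a" and "y = real n + 2 - a"
  have pos: "0 < x" "0 < y" "0 < Gamma x" "0 < Gamma y"
    using a_pos a_less_1 by (auto simp: x_def y_def)
  have "hyp_moment (Suc n) = ((real n + 1) * fact n)\<^sup>2 / (Gamma (x + 1) * Gamma (y + 1))"
    by (simp add: hyp_moment_def x_def y_def algebra_simps)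
  then have "x * y * hyp_moment (Suc n) = (real n + 1)\<^sup>2 * hyp_moment n"
    using pos by (simp add: Gamma_plus1 not_nonpos_Ints_real hyp_moment_def power_mult_distrib
        flip: x_def y_def)
  moreover have "x * y = (real n + 1)\<^sup>2 + (real n + 1) + \<kappa>"
    by (simp add: x_def y_def \<kappa>_def power2_eq_square algebra_simps)
  ultimately show ?thesis by simp
qed

lemma hyp_coeff_mult_hyp_moment:
  "((real k)\<^sup>2 + real k + \<kappa>) * (hyp_coeff k * hyp_moment k) = sin (pi * a) / pi"
proof (induction k)
  case 0
  have "\<kappa> / (Gamma (1 + a) * Gamma (2 - a)) = 1 / (Gamma a * Gamma (1 - a))"
    using a_pos a_less_1 Gamma_plus1[of a] Gamma_plus1[of "1 - a"]
    by (simp add: \<kappa>_def not_nonpos_Ints_real add.commute)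
  then show ?case
    using Gamma_reflection_real[of a] by (simp add: hyp_moment_def)
next
  case (Suc k)
  have "((real (Suc k))\<^sup>2 + real (Suc k) + \<kappa>) * (hyp_coeff (Suc k) * hyp_moment (Suc k)) =
      hyp_coeff (Suc k) * (((real k + 1)\<^sup>2 + (real k + 1) + \<kappa>) * hyp_moment (Suc k))"
    by (simp add: ac_simps)
  also have "\<dots> = ((real k + 1)\<^sup>2 * hyp_coeff (Suc k)) * hyp_moment k"
    unfolding hyp_moment_Suc by simp
  also have "\<dots> = ((real k)\<^sup>2 + real k + \<kappa>) * (hyp_coeff k * hyp_moment k)"
    unfolding hyp_coeff_Suc by simp
  finally show ?case unfolding Suc.IH .
qed

lemma hyp_coeff_mult_hyp_moment_sums:
  "(\<lambda>k. hyp_coeff k * hyp_moment k) sums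
    (sin (pi * a) / 2 * (Gamma_half_quotient a * Gamma_half_quotient (1 - a)))"
proof -
  have "hyp_coeff k * hyp_moment k = sin (pi * a) / pi * (1 / ((real k + a) * (real k + 1 - a)))"
      for k
  proof -
    have "hyp_coeff k * hyp_moment k = sin (pi * a) / pi * (1 / ((real k)\<^sup>2 + real k + \<kappa>))"
      using hyp_coeff_mult_hyp_moment[of k] quadratic_plus_\<kappa>_pos[of k]
      by (simp add: eq_divide_eq mult_ac)
    also have "(real k)\<^sup>2 + real k + \<kappa> = (real k + a) * (real k + 1 - a)"
      by (simp add: \<kappa>_def power2_eq_square algebra_simps)
    finally show ?thesis .
  qed
  then show ?thesis
    using sums_mult[OF inverse_quadratic_sums[OF a_pos a_less_1], of "sin (pi * a) / pi"] by simp
qed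

lemma hyp_moment_Suc_le: "(real n + 2) * hyp_moment (Suc n) \<le> (real n + 1) * hyp_moment n"
proof -
  have "(real n + 1) * ((real n + 2) * hyp_moment (Suc n)) \<le>
      ((real n + 1)\<^sup>2 + (real n + 1) + \<kappa>) * hyp_moment (Suc n)"
    using \<kappa>_pos hyp_moment_pos[of "Suc n"] by (simp add: power2_eq_square algebra_simps)
  also have "\<dots> = (real n + 1) * ((real n + 1) * hyp_moment n)"
    unfolding hyp_moment_Suc by (simp add: power2_eq_square)
  finally show ?thesis by (rule mult_left_le_imp_le) simp
qed

lemma hyp_moment_le: "(real n + 1) * hyp_moment n \<le> hyp_moment 0"
proof (induction n)
  case (Suc n)
  then show ?case using hyp_moment_Suc_le[of n] by (simp add: add.commute)
qed simp

lemma hyp_moment_antimono: "hyp_moment (n + k) \<le> hyp_moment k"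
proof (induction n)
  case (Suc n)
  have "(real (n + k) + 1) * hyp_moment (Suc (n + k)) \<le>
      (real (n + k) + 2) * hyp_moment (Suc (n + k))"
    using hyp_moment_pos[of "Suc (n + k)"] by (intro mult_right_mono) auto
  also have "\<dots> \<le> (real (n + k) + 1) * hyp_moment (n + k)" by (rule hyp_moment_Suc_le)
  finally have "hyp_moment (Suc (n + k)) \<le> hyp_moment (n + k)"
    by (rule mult_left_le_imp_le) simp
  then show ?case using Suc.IH by simp
qed simp

lemma product_moment_sums: "(\<lambda>k. hyp_coeff k * hyp_moment (n + k)) sums product_moment n"
  unfolding product_moment_def
proof (rule summable_sums, rule summable_comparison_test')
  show "summable (\<lambda>k. hyp_coeff k * hyp_moment k)"
    using hyp_coeff_mult_hyp_moment_sums by (rule sums_summable)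
  show "norm (hyp_coeff k * hyp_moment (n + k)) \<le> hyp_coeff k * hyp_moment k" for k
    using hyp_moment_antimono[of n k] hyp_coeff_pos[of k] hyp_moment_pos[of "n + k"] by simp
qed

lemma product_moment_0:
  "product_moment 0 = sin (pi * a) / 2 * (Gamma_half_quotient a * Gamma_half_quotient (1 - a))"
  using product_moment_sums[of 0] unfolding add_0
  by (rule sums_unique2) (rule hyp_coeff_mult_hyp_moment_sums)

text \<open>The discrete form of the boundary terms in the integration by parts which shows that the third
  order operator annihilating products of solutions is skew-adjoint.\<close>
definition certificate :: "nat \<Rightarrow> nat \<Rightarrow> real" where
  "certificate n k = (real k)\<^sup>2 * hyp_coeff k *
     (((real n + 2 * \<kappa>) * real (n + k) + real n * \<kappa>) * (hyp_moment (n + k) / (real (n + k))\<^sup>2))"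

lemma hyp_moment_pred:
  assumes "0 < n"
  shows "(real n)\<^sup>2 * hyp_moment (n - 1) = ((real n)\<^sup>2 + real n + \<kappa>) * hyp_moment n"
  using hyp_moment_Suc[of "n - 1"] assms by simp

definition certificate_factor :: "nat \<Rightarrow> nat \<Rightarrow> real" where
  "certificate_factor n k =
     real n ^ 3 + 2 * (real n)\<^sup>2 + 3 * real n * \<kappa> - (real n + 2 * \<kappa>) * real (n + k)"

lemma certificate_eq:
  "certificate n k = hyp_coeff k *
     (real n ^ 3 * hyp_moment (n - 1 + k) - certificate_factor n k * hyp_moment (n + k))"
proof (cases "n + k = 0")
  case False
  define N where "N = real (n + k)"
  have "N \<noteq> 0" using False unfolding N_def of_nat_eq_0_iff .
  have "real k = N - real n" by (simp add: N_def)
  define M where "M = hyp_moment (n + k) / N\<^sup>2"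
  have moment: "hyp_moment (n + k) = N\<^sup>2 * M" using \<open>N \<noteq> 0\<close> by (simp add: M_def)
  have moment_pred: "real n ^ 3 * hyp_moment (n - 1 + k) = real n ^ 3 * ((N\<^sup>2 + N + \<kappa>) * M)"
  proof (cases n)
    case (Suc m)
    then have "N\<^sup>2 * hyp_moment (n - 1 + k) = N\<^sup>2 * ((N\<^sup>2 + N + \<kappa>) * M)"
      using hyp_moment_pred[of "n + k"] moment by (simp add: N_def)
    then show ?thesis using \<open>N \<noteq> 0\<close> by simp
  qed simp
  have "certificate n k =
      hyp_coeff k * ((real k)\<^sup>2 * (((real n + 2 * \<kappa>) * N + real n * \<kappa>) * M))"
    by (simp only: certificate_def M_def N_def ac_simps)
  also have "(real k)\<^sup>2 * (((real n + 2 * \<kappa>) * N + real n * \<kappa>) * M) =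
      real n ^ 3 * ((N\<^sup>2 + N + \<kappa>) * M)
      - certificate_factor n k * (N\<^sup>2 * M)"
    unfolding \<open>real k = N - real n\<close> certificate_factor_def N_def[symmetric]
    by (simp add: power2_eq_square power3_eq_cube algebra_simps)
  finally show ?thesis unfolding moment_pred moment .
qed (simp add: certificate_def certificate_factor_def)

lemma certificate_Suc:
  "certificate n (Suc k) = hyp_coeff k *
     (((2 * real n + 1) * ((real n)\<^sup>2 + real n + 2 * \<kappa>) - certificate_factor n k) * hyp_moment (n + k)
    - (real n + 1) * ((real n)\<^sup>2 + 2 * real n + 4 * \<kappa>) * hyp_moment (n + 1 + k))"
proof -
  define N where "N = real (n + k)"
  have "N + 1 \<noteq> 0" "real k = N - real n" by (simp_all add: N_def add_nonneg_eq_0_iff)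
  define M where "M = hyp_moment (n + 1 + k) / (N + 1)\<^sup>2"
  have moment_Suc: "hyp_moment (n + 1 + k) = (N + 1)\<^sup>2 * M"
    using \<open>N + 1 \<noteq> 0\<close> by (simp add: M_def)
  have moment: "hyp_moment (n + k) = ((N + 1)\<^sup>2 + (N + 1) + \<kappa>) * M"
    using hyp_moment_Suc[of "n + k"] \<open>N + 1 \<noteq> 0\<close> by (simp add: M_def N_def field_simps)
  have "certificate n (Suc k) = (real k + 1)\<^sup>2 * hyp_coeff (Suc k) *
      (((real n + 2 * \<kappa>) * (N + 1) + real n * \<kappa>) * M)"
    by (simp add: certificate_def M_def N_def algebra_simps)
  also have "\<dots> = hyp_coeff k * (((real k)\<^sup>2 + real k + \<kappa>) *
      (((real n + 2 * \<kappa>) * (N + 1) + real n * \<kappa>) * M))"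
    unfolding hyp_coeff_Suc by simp
  also have "((real k)\<^sup>2 + real k + \<kappa>) * (((real n + 2 * \<kappa>) * (N + 1) + real n * \<kappa>) * M) =
      ((2 * real n + 1) * ((real n)\<^sup>2 + real n + 2 * \<kappa>) - certificate_factor n k) *
        (((N + 1)\<^sup>2 + (N + 1) + \<kappa>) * M)
      - (real n + 1) * ((real n)\<^sup>2 + 2 * real n + 4 * \<kappa>) * ((N + 1)\<^sup>2 * M)"
    unfolding \<open>real k = N - real n\<close> certificate_factor_def N_def[symmetric]
    by (simp add: power2_eq_square power3_eq_cube algebra_simps)
  finally show ?thesis unfolding moment moment_Suc .
qed

lemma certificate_diff:
  "certificate n k - certificate n (Suc k) = real n ^ 3 * (hyp_coeff k * hyp_moment (n - 1 + k))
    - (2 * real n + 1) * ((real n)\<^sup>2 + real n + 2 * \<kappa>) * (hyp_coeff k * hyp_moment (n + k))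
    + (real n + 1) * ((real n)\<^sup>2 + 2 * real n + 4 * \<kappa>) * (hyp_coeff k * hyp_moment (n + 1 + k))"
  unfolding certificate_eq[of n k] certificate_Suc by (simp add: algebra_simps)

lemma certificate_le:
  "certificate n k \<le> hyp_moment 0 *
     (((real n + 2 * \<kappa>) * real (n + k) + real n * \<kappa>) / (real (n + k))\<^sup>2)"
proof -
  define N where "N = real (n + k)"
  define B where "B = ((real n + 2 * \<kappa>) * N + real n * \<kappa>) / N\<^sup>2"
  have "0 \<le> B" using \<kappa>_pos by (simp add: B_def N_def)
  have "real k * hyp_coeff k \<le> real k * (1 / (real k + 1))"
    by (intro mult_left_mono hyp_coeff_le) simp
  also have "\<dots> \<le> 1" by simp
  finally have "real k * hyp_coeff k \<le> 1" .
  moreover have "real k * hyp_moment (n + k) \<le> (N + 1) * hyp_moment (n + k)"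
    using hyp_moment_pos[of "n + k"] by (intro mult_right_mono) (simp_all add: N_def)
  then have "real k * hyp_moment (n + k) \<le> hyp_moment 0"
    using hyp_moment_le[of "n + k"] by (simp add: N_def)
  ultimately have "(real k * hyp_coeff k) * (real k * hyp_moment (n + k)) \<le> 1 * hyp_moment 0"
    using hyp_coeff_pos[of k] hyp_moment_pos[of "n + k"] by (intro mult_mono) auto
  from mult_right_mono[OF this \<open>0 \<le> B\<close>] show ?thesis
    by (simp add: certificate_def B_def N_def power2_eq_square ac_simps)
qed

lemma certificate_tendsto_0: "certificate n \<longlonglongrightarrow> 0"
proof (rule tendsto_sandwich[of "\<lambda>_. 0"])
  show "\<forall>\<^sub>F k in sequentially. 0 \<le> certificate n k"
    using \<kappa>_pos hyp_coeff_pos hyp_moment_pos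
    by (intro always_eventually allI) (simp add: certificate_def less_imp_le)
  show "\<forall>\<^sub>F k in sequentially. certificate n k \<le> hyp_moment 0 *
      (((real n + 2 * \<kappa>) * real (n + k) + real n * \<kappa>) / (real (n + k))\<^sup>2)"
    by (intro always_eventually allI certificate_le)
  show "(\<lambda>k. hyp_moment 0 * (((real n + 2 * \<kappa>) * real (n + k) + real n * \<kappa>) / (real (n + k))\<^sup>2))
      \<longlonglongrightarrow> 0"
    unfolding of_nat_add by real_asymp
qed simp

lemma product_moment_recurrence:
  "real n ^ 3 * product_moment (n - 1)
    - (2 * real n + 1) * ((real n)\<^sup>2 + real n + 2 * \<kappa>) * product_moment n
    + (real n + 1) * ((real n)\<^sup>2 + 2 * real n + 4 * \<kappa>) * product_moment (n + 1) = 0"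
  (is "?lhs = 0")
proof (rule sums_unique2)
  show "(\<lambda>k. certificate n k - certificate n (Suc k)) sums ?lhs"
    unfolding certificate_diff by (intro sums_add sums_diff sums_mult product_moment_sums)
  show "(\<lambda>k. certificate n k - certificate n (Suc k)) sums 0"
    using telescope_sums'[OF certificate_tendsto_0, of n] by (simp add: certificate_def)
qed

definition hyp :: "real \<Rightarrow> real" where
  "hyp x = (\<Sum>k. hyp_coeff k * x ^ k)"

definition hyp_product :: "real \<Rightarrow> real" where
  "hyp_product x = hyp x * hyp (1 - x)"

lemma hyp_sums:
  assumes "0 \<le> x" "x < 1"
  shows "(\<lambda>k. hyp_coeff k * x ^ k) sums hyp x"
  unfolding hyp_def
proof (rule summable_sums, rule summable_comparison_test')
  show "summable (\<lambda>k. x ^ k)" using assms by simp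
  show "norm (hyp_coeff k * x ^ k) \<le> x ^ k" for k
    using hyp_coeff_pos[of k] hyp_coeff_le_1[of k] assms by (simp add: mult_left_le_one_le)
qed

lemma hyp_nonneg:
  assumes "0 \<le> x" "x < 1"
  shows "0 \<le> hyp x"
  using sums_le[OF _ sums_zero hyp_sums[OF assms]] hyp_coeff_pos assms(1)
  by (simp add: less_imp_le)

lemma has_integral_hyp_moment: "((\<lambda>x. x ^ n * hyp (1 - x)) has_integral hyp_moment n) {0<..<1}"
proof (rule has_integral_iff_sums_nonneg[THEN iffD2, OF _ _ _ hyp_moment_sums])
  show "((\<lambda>x. hyp_coeff k * (x ^ n * (1 - x) ^ k)) has_integral
      hyp_coeff k * Beta (real n + 1) (real k + 1)) {0<..<1}" for k
    by (intro has_integral_mult_right has_integral_power_mult_power)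
  show "0 \<le> hyp_coeff k * (x ^ n * (1 - x) ^ k)" if "x \<in> {0<..<1}" for k x
    using that hyp_coeff_pos[of k] by simp
  show "(\<lambda>k. hyp_coeff k * (x ^ n * (1 - x) ^ k)) sums (x ^ n * hyp (1 - x))" if "x \<in> {0<..<1}"
      for x
    using sums_mult[OF hyp_sums[of "1 - x"], of "x ^ n"] that by (simp add: mult_ac)
qed

lemma has_integral_product_moment:
  "((\<lambda>x. x ^ n * hyp_product x) has_integral product_moment n) {0<..<1}"
proof (rule has_integral_iff_sums_nonneg[THEN iffD2, OF _ _ _ product_moment_sums])
  show "((\<lambda>x. hyp_coeff k * (x ^ (n + k) * hyp (1 - x))) has_integral
      hyp_coeff k * hyp_moment (n + k)) {0<..<1}" for k
    by (intro has_integral_mult_right has_integral_hyp_moment)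
  show "0 \<le> hyp_coeff k * (x ^ (n + k) * hyp (1 - x))" if "x \<in> {0<..<1}" for k x
    using that hyp_coeff_pos[of k] hyp_nonneg[of "1 - x"] by simp
  show "(\<lambda>k. hyp_coeff k * (x ^ (n + k) * hyp (1 - x))) sums (x ^ n * hyp_product x)"
    if "x \<in> {0<..<1}" for x
    using sums_mult[OF hyp_sums[of x], of "x ^ n * hyp (1 - x)"] that
    by (simp add: hyp_product_def power_add mult_ac)
qed

definition product_functional :: "real poly \<Rightarrow> real" where
  "product_functional p = integral {0<..<1} (\<lambda>x. poly p x * hyp_product x)"

lemma has_integral_product_functional:
  "((\<lambda>x. poly p x * hyp_product x) has_integral product_functional p) {0<..<1}"
proof -
  have "((\<lambda>x. \<Sum>i\<le>degree p. coeff p i * (x ^ i * hyp_product x)) has_integral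
      (\<Sum>i\<le>degree p. coeff p i * product_moment i)) {0<..<1}"
    by (intro has_integral_sum has_integral_mult_right has_integral_product_moment) simp
  then have "(\<lambda>x. poly p x * hyp_product x) integrable_on {0<..<1}"
    unfolding poly_altdef sum_distrib_right mult.assoc by (rule has_integral_integrable)
  then show ?thesis unfolding product_functional_def by (rule integrable_integral)
qed

lemma product_functional_add:
  "product_functional (p + r) = product_functional p + product_functional r"
proof (rule has_integral_unique[OF has_integral_product_functional])
  show "((\<lambda>x. poly (p + r) x * hyp_product x) has_integral
      product_functional p + product_functional r) {0<..<1}"
    unfolding poly_add distrib_right by (intro has_integral_add has_integral_product_functional)
qed

lemma product_functional_smult: "product_functional (smult c p) = c * product_functional p"
  by (simp add: product_functional_def mult.assoc)

lemma product_functional_0 [simp]: "product_functional 0 = 0"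
  by (simp add: product_functional_def)

lemma product_functional_diff:
  "product_functional (p - r) = product_functional p - product_functional r"
  using product_functional_add[of "p - r" r] by simp

lemma product_functional_monom: "product_functional (monom c n) = c * product_moment n"
  using has_integral_unique[OF has_integral_product_functional]
    has_integral_mult_right[OF has_integral_product_moment, of c n]
  by (simp add: poly_monom mult.assoc)

text \<open>The formal adjoint of the third order operator annihilating \<open>u(x) u(1 - x)\<close>.\<close>
definition adjoint_op :: "real poly \<Rightarrow> real poly" where
  "adjoint_op p = smult (4 * \<kappa>) ([:0, 1, -1:] * pderiv p) - smult (2 * \<kappa>) ([:-1, 2:] * p)
     - pderiv ([:0, 1, -1:] * pderiv ([:0, 1, -1:] * pderiv p))"

lemma adjoint_op_add: "adjoint_op (p + r) = adjoint_op p + adjoint_op r"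
  by (simp only: adjoint_op_def pderiv_add distrib_left smult_add_right add_diff_add)

lemma adjoint_op_monom:
  "adjoint_op (monom c n) = monom (- c * real n ^ 3) (n - 1)
     + monom (c * (2 * real n + 1) * ((real n)\<^sup>2 + real n + 2 * \<kappa>)) n
     - monom (c * (real n + 1) * ((real n)\<^sup>2 + 2 * real n + 4 * \<kappa>)) (n + 1)"
proof -
  have pderiv_eq: "pderiv (monom c n) = monom (c * real n) (n - 1)" for c :: real and n
    by (simp add: pderiv_monom mult.commute)
  have quadratic: "[:0, 1, -1:] * pderiv (monom c n) =
      monom (c * real n) n - monom (c * real n) (n + 1)"
    for c :: real and n
    unfolding pderiv_eq by (cases n) (auto intro!: poly_ext simp: poly_monom algebra_simps)
  show ?thesis
    unfolding adjoint_op_def quadratic pderiv_diff right_diff_distrib unfolding pderiv_eq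
    by (cases n) (auto intro!: poly_ext
        simp: poly_monom algebra_simps power2_eq_square power3_eq_cube)
qed

lemma product_functional_adjoint_op: "product_functional (adjoint_op p) = 0"
proof -
  have "product_functional (adjoint_op (monom c n)) = 0" for c n
  proof -
    have "product_functional (adjoint_op (monom c n)) = - c * (real n ^ 3 * product_moment (n - 1)
        - (2 * real n + 1) * ((real n)\<^sup>2 + real n + 2 * \<kappa>) * product_moment n
        + (real n + 1) * ((real n)\<^sup>2 + 2 * real n + 4 * \<kappa>) * product_moment (n + 1))"
      unfolding adjoint_op_monom product_functional_add product_functional_diff
        product_functional_monom
      by (simp add: algebra_simps)
    then show ?thesis unfolding product_moment_recurrence by simp
  qed
  moreover have "adjoint_op 0 = 0" by (simp add: adjoint_op_def)
  ultimately have "product_functional (adjoint_op (\<Sum>i\<in>I. monom (coeff p i) i)) = 0" for I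
    by (induction I rule: infinite_finite_induct)
       (simp_all add: adjoint_op_add product_functional_add)
  from this[of "{..degree p}"] show ?thesis by (simp add: poly_as_sum_of_monoms)
qed

definition legendre_coeff :: "nat \<Rightarrow> real" where
  "legendre_coeff n = product_functional (shifted_legendre n)"

lemma legendre_coeff_recurrence:
  "(real n + 1)\<^sup>2 * (real n * (real n + 2) + 4 * \<kappa>) * legendre_coeff (n + 1) =
     (real n)\<^sup>2 * ((real n)\<^sup>2 - 1 + 4 * \<kappa>) * legendre_coeff (n - 1)"
proof -
  define c d where "c = real n * real (n + 1) / (2 * real (2 * n + 1))"
      and "d = 1 / real (2 * n + 1)"
  let ?w = legendre_coeff and ?Q = shifted_legendre and ?s = "[:0, 1, -1::real:]"
  have c_eq: "c = real n * (real n + 1) * d / 2" by (simp add: c_def d_def)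
  have pred: "real (n - 1) * real (n - 1 + 1) * c = (real n - 1) * real n * c"
    by (cases n) (simp_all add: c_def)
  have "pderiv (?s * pderiv (?s * pderiv (?Q n))) = smult c
      (smult (- (real (n - 1) * real (n - 1 + 1))) (?Q (n - 1))
       - smult (- (real (n + 1) * real (n + 1 + 1))) (?Q (n + 1)))"
    unfolding quadratic_mult_pderiv_shifted_legendre_eq_diff[of n] c_def[symmetric]
    by (simp only: pderiv_smult pderiv_diff mult_smult_right right_diff_distrib shifted_legendre_ode
        smult_diff_right)
  then have "0 = 4 * \<kappa> * (c * (?w (n - 1) - ?w (n + 1)))
      - 2 * \<kappa> * (d * (real (n + 1) * ?w (n + 1) + real n * ?w (n - 1)))
      - c * (- (real (n - 1) * real (n - 1 + 1)) * ?w (n - 1)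
        - - (real (n + 1) * real (n + 1 + 1)) * ?w (n + 1))"
    using product_functional_adjoint_op[of "?Q n"]
    unfolding adjoint_op_def quadratic_mult_pderiv_shifted_legendre_eq_diff[of n] c_def[symmetric]
      linear_mult_shifted_legendre d_def[symmetric]
    by (simp only: product_functional_diff product_functional_smult product_functional_add
        legendre_coeff_def)
  also have "\<dots> = 4 * \<kappa> * (c * (?w (n - 1) - ?w (n + 1)))
      - 2 * \<kappa> * (d * ((real n + 1) * ?w (n + 1) + real n * ?w (n - 1)))
      + (real (n - 1) * real (n - 1 + 1) * c) * ?w (n - 1)
      - c * ((real n + 1) * (real n + 2)) * ?w (n + 1)"
    by (simp add: algebra_simps)
  also have "\<dots> = d / 2 * ((real n)\<^sup>2 * ((real n)\<^sup>2 - 1 + 4 * \<kappa>) * ?w (n - 1)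
      - (real n + 1)\<^sup>2 * (real n * (real n + 2) + 4 * \<kappa>) * ?w (n + 1))"
    unfolding pred unfolding c_eq by (simp add: field_simps power2_eq_square)
  finally show ?thesis by (simp add: d_def del: of_nat_add)
qed

lemma legendre_coeff_odd: "odd n \<Longrightarrow> legendre_coeff n = 0"
proof (induction n rule: induct_nat_012)
  case 1
  then show ?case using legendre_coeff_recurrence[of 0] \<kappa>_pos by simp
next
  case (ge2 n)
  have "0 < (real (n + 1) + 1)\<^sup>2 * (real (n + 1) * (real (n + 1) + 2) + 4 * \<kappa>)"
    using \<kappa>_pos by (intro mult_pos_pos add_nonneg_pos) auto
  moreover have "(real (n + 1) + 1)\<^sup>2 * (real (n + 1) * (real (n + 1) + 2) + 4 * \<kappa>)
      * legendre_coeff (Suc (Suc n)) = 0"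
    using legendre_coeff_recurrence[of "n + 1"] ge2 by simp
  ultimately show ?case by (metis mult_eq_0_iff less_irrefl)
qed simp

definition Gamma_weight :: "nat \<Rightarrow> real" where
  "Gamma_weight m = Gamma_half_quotient (real m + a) * Gamma_half_quotient (real m + 1 - a)"

lemma Gamma_weight_Suc:
  "((real m)\<^sup>2 + 2 * real m + 3/4 + \<kappa>) * Gamma_weight (Suc m) =
      ((real m)\<^sup>2 + real m + \<kappa>) * Gamma_weight m"
proof -
  define x y where "x = real m + a" and "y = real m + 1 - a"
  have "0 < x" "0 < y" using a_pos a_less_1 by (simp_all add: x_def y_def)
  have "((x + 1/2) * Gamma_half_quotient (x + 1)) * ((y + 1/2) * Gamma_half_quotient (y + 1)) =
      (x * Gamma_half_quotient x) * (y * Gamma_half_quotient y)"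
    unfolding Gamma_half_quotient_plus1[OF not_nonpos_Ints_real[OF \<open>0 < x\<close>]]
      Gamma_half_quotient_plus1[OF not_nonpos_Ints_real[OF \<open>0 < y\<close>]] ..
  moreover have "Gamma_weight (Suc m) = Gamma_half_quotient (x + 1) * Gamma_half_quotient (y + 1)"
    by (simp add: Gamma_weight_def x_def y_def algebra_simps)
  moreover have "Gamma_weight m = Gamma_half_quotient x * Gamma_half_quotient y"
    by (simp add: Gamma_weight_def x_def y_def)
  moreover have "(x + 1/2) * (y + 1/2) = (real m)\<^sup>2 + 2 * real m + 3/4 + \<kappa>"
    "x * y = (real m)\<^sup>2 + real m + \<kappa>"
    by (simp_all add: x_def y_def \<kappa>_def power2_eq_square field_simps)
  ultimately show ?thesis by (metis mult.assoc mult.left_commute)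
qed

lemma legendre_coeff_even:
  "legendre_coeff (2 * m) = sin (pi * a) / 2 * (ncbinom m)\<^sup>2 * Gamma_weight m"
proof (induction m)
  case 0
  have "product_functional 1 = product_moment 0" using product_functional_monom[of 1 0] by simp
  then show ?case by (simp add: legendre_coeff_def Gamma_weight_def product_moment_0)
next
  case (Suc m)
  define A B where "A = (real m)\<^sup>2 + real m + \<kappa>" and "B = (real m)\<^sup>2 + 2 * real m + 3/4 + \<kappa>"
  have "0 < B" using \<kappa>_pos by (simp add: B_def add_nonneg_pos)
  have "(2 * real m + 2)\<^sup>2 * (4 * B) * legendre_coeff (2 * Suc m) =
      (2 * real m + 1)\<^sup>2 * (4 * A) * legendre_coeff (2 * m)"
    using legendre_coeff_recurrence[of "2 * m + 1"]
    by (simp add: A_def B_def power2_eq_square algebra_simps)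
  then have "legendre_coeff (2 * Suc m) =
      ((2 * real m + 1) / (2 * real m + 2))\<^sup>2 * (A / B) * legendre_coeff (2 * m)"
    using \<open>0 < B\<close> by (simp add: power_divide field_simps)
  also have "\<dots> = sin (pi * a) / 2 * (ncbinom (Suc m))\<^sup>2 * (A * Gamma_weight m / B)"
    unfolding Suc.IH ncbinom_Suc power_mult_distrib by (simp add: ac_simps)
  also have "A * Gamma_weight m / B = Gamma_weight (Suc m)"
    using Gamma_weight_Suc[of m] \<open>0 < B\<close> by (simp add: A_def B_def field_simps)
  finally show ?case .
qed

end

section \<open>The Legendre expansion of the product\<close>

lemma continuous_extension_mult_power_series:
  fixes c :: "nat \<Rightarrow> real"
  assumes "decseq c" "c \<longlonglongrightarrow> 0"
  obtains v where "continuous_on {0..1} v"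
    "\<And>x f. 0 \<le> x \<Longrightarrow> x < 1 \<Longrightarrow> (\<lambda>k. c k * x ^ k) sums f \<Longrightarrow> v x = (1 - x) * f"
proof -
  define d where "d k = (case k of 0 \<Rightarrow> c 0 | Suc j \<Rightarrow> c (Suc j) - c j)" for k
  define v where "v x = (\<Sum>k. d k * x ^ k)" for x
  have "summable (\<lambda>k. c k - c (Suc k))"
    using telescope_sums'[OF assms(2)] by (rule sums_summable)
  then have "summable (\<lambda>k. \<bar>d (Suc k)\<bar>)"
    using decseq_SucD[OF assms(1)] by (simp add: d_def abs_of_nonpos)
  then have "summable (\<lambda>k. \<bar>d k\<bar>)" using summable_Suc_iff[of "\<lambda>k. \<bar>d k\<bar>"] by blast
  then have "continuous_on {0..1} v"
    unfolding v_def
  proof (rule continuous_on_suminf_M_test[rotated 2])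
    show "norm (d k * x ^ k) \<le> \<bar>d k\<bar>" if "x \<in> {0..1}" for k x
      using that by (simp add: abs_mult power_abs[symmetric] mult_left_le power_le_one)
  qed (intro continuous_intros)
  moreover have "v x = (1 - x) * f" if f: "(\<lambda>k. c k * x ^ k) sums f" for x f
  proof -
    have "(\<lambda>k. c (Suc k) * x ^ Suc k - x * (c k * x ^ k)) sums ((f - c 0) - x * f)"
      using f sums_Suc_iff[of "\<lambda>k. c k * x ^ k" "f - c 0"] by (intro sums_diff sums_mult) simp_all
    then have "(\<lambda>k. d (Suc k) * x ^ Suc k) sums ((f - c 0) - x * f)"
      by (simp add: d_def algebra_simps)
    then have "(\<lambda>k. d k * x ^ k) sums ((f - c 0) - x * f + d 0 * x ^ 0)" by (rule sums_Suc)
    then show ?thesis unfolding v_def by (simp add: sums_iff d_def algebra_simps)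
  qed
  ultimately show ?thesis using that by blast
qed

context legendre_function
begin

lemma decseq_hyp_coeff: "decseq hyp_coeff"
proof (rule decseq_SucI)
  fix k
  have "(real k + 1)\<^sup>2 * hyp_coeff (Suc k) \<le> (real k + 1)\<^sup>2 * hyp_coeff k"
    unfolding hyp_coeff_Suc using \<kappa>_le_quarter hyp_coeff_pos[of k]
    by (intro mult_right_mono) (auto simp: power2_eq_square algebra_simps)
  then show "hyp_coeff (Suc k) \<le> hyp_coeff k" by (rule mult_left_le_imp_le) simp
qed

lemma hyp_coeff_tendsto_0: "hyp_coeff \<longlonglongrightarrow> 0"
proof (rule tendsto_sandwich[of "\<lambda>_. 0"])
  show "(\<lambda>k. 1 / (real k + 1)) \<longlonglongrightarrow> 0" by real_asymp
qed (use hyp_coeff_le hyp_coeff_pos in \<open>auto intro!: always_eventually simp: less_imp_le\<close>)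

lemma continuous_extension_weighted_hyp_product:
  obtains g where "continuous_on {0..1} g"
    "\<And>x. 0 < x \<Longrightarrow> x < 1 \<Longrightarrow> g x = x * (1 - x) * hyp_product x"
proof -
  obtain v where v: "continuous_on {0..1} v"
    "\<And>x f. 0 \<le> x \<Longrightarrow> x < 1 \<Longrightarrow> (\<lambda>k. hyp_coeff k * x ^ k) sums f \<Longrightarrow> v x = (1 - x) * f"
    using continuous_extension_mult_power_series[OF decseq_hyp_coeff hyp_coeff_tendsto_0] by blast
  have "continuous_on {0..1} (\<lambda>x. v (1 - x))"
    by (rule continuous_on_compose2[OF v(1)]) (auto intro!: continuous_intros)
  then have "continuous_on {0..1} (\<lambda>x. v x * v (1 - x))" by (intro continuous_on_mult v(1))
  moreover have "v x * v (1 - x) = x * (1 - x) * hyp_product x" if "0 < x" "x < 1" for x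
    using v(2)[OF _ _ hyp_sums[of x]] v(2)[OF _ _ hyp_sums[of "1 - x"]] that
    by (simp add: hyp_product_def)
  ultimately show ?thesis using that by blast
qed

lemma product_functional_sums:
  "(\<lambda>m. (4 * real m + 1) * legendre_coeff (2 * m) * poly_inner (shifted_legendre (2 * m)) p)
    sums product_functional p"
proof -
  define f where "f n = real (2 * n + 1) * legendre_coeff n * poly_inner (shifted_legendre n) p"
      for n
  have "f sums product_functional p"
    unfolding f_def legendre_coeff_def
    by (intro shifted_legendre_functional_sums product_functional_add product_functional_smult)
  moreover have "f n = 0" if "n \<notin> range ((*) 2)" for n
    using that legendre_coeff_odd[of n] by (auto simp: f_def elim: evenE)
  ultimately have "(\<lambda>m. f (2 * m)) sums product_functional p"
    using sums_mono_reindex[of "(*) 2" f] by (simp add: strict_mono_def)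
  then show ?thesis by (simp add: f_def add.commute)
qed

lemma Gamma_weight_pos: "0 < Gamma_weight m"
  using a_pos a_less_1 by (simp add: Gamma_weight_def Gamma_half_quotient_pos)

lemma Gamma_term_minus_of_real:
  "Gamma_term (- of_real a) m =
     of_real ((-1) ^ (m + 1) * (ncbinom m ^ 3 * (4 * real m + 1) * Gamma_weight m))"
proof -
  have "of_nat m - - complex_of_real a = of_real (real m + a)"
    "of_nat m + - complex_of_real a + 1 = of_real (real m + 1 - a)"
    by simp_all
  then show ?thesis
    unfolding Gamma_term_eq by (simp only: Gamma_half_quotient_of_real)
        (simp add: Gamma_weight_def ac_simps)
qed

definition expansion_coeff :: "nat \<Rightarrow> real" where
  "expansion_coeff m = (4 * real m + 1) * legendre_coeff (2 * m)"

lemma expansion_coeff_eq: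
  "expansion_coeff m = sin (pi * a) / 2 * ((ncbinom m)\<^sup>2 * (4 * real m + 1) * Gamma_weight m)"
  unfolding expansion_coeff_def legendre_coeff_even by (simp only: ac_simps)

lemma sin_pi_a_pos: "0 < sin (pi * a)"
  using a_pos a_less_1 by (simp add: sin_gt_zero)

lemma abs_expansion_coeff_mult_ncbinom:
  "\<bar>expansion_coeff m\<bar> * ncbinom m = sin (pi * a) / 2 * norm (Gamma_term (- of_real a) m)"
  unfolding expansion_coeff_eq Gamma_term_minus_of_real norm_of_real
  using sin_pi_a_pos Gamma_weight_pos[of m]
  by (simp add: abs_mult power_abs power2_eq_square power3_eq_cube ac_simps)

lemma hyp_product_expansion:
  assumes "0 < x" "x < 1"
  shows "(\<lambda>m. expansion_coeff m * poly (shifted_legendre (2 * m)) x) sums hyp_product x"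
proof -
  let ?Q = "\<lambda>m. shifted_legendre (2 * m)"
  obtain g where g: "continuous_on {0..1} g"
    and g_eq: "\<And>x. 0 < x \<Longrightarrow> x < 1 \<Longrightarrow> g x = x * (1 - x) * hyp_product x"
    using continuous_extension_weighted_hyp_product by blast
  define f where "f m x = expansion_coeff m * (x * (1 - x) * poly (?Q m) x)" for m x
  define C where "C m = sin (pi * a) / 2 * norm (Gamma_term (- of_real a) m)" for m
  have "(\<lambda>m. f m x) sums g x"
  proof (rule sums_if_moments_sums[of 0 1 f g C])
    show "continuous_on {0..1} (f m)" for m unfolding f_def by (intro continuous_intros)
    show "norm (f m x) \<le> C m" if "x \<in> {0..1}" for m x
      unfolding C_def abs_expansion_coeff_mult_ncbinom[symmetric] f_def real_norm_def
        abs_mult[of "expansion_coeff m"]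
      using shifted_legendre_even_bound[OF that] by (intro mult_left_mono) auto
    show "summable C"
      unfolding C_def by (intro summable_mult summable_norm_Gamma_term)
    fix p :: "real poly"
    have "integral {0..1} (\<lambda>x. poly p x * f m x) =
        expansion_coeff m * poly_inner (?Q m) ([:0, 1, -1:] * p)" for m
    proof -
      have "poly p x * f m x = expansion_coeff m * (poly (?Q m) x * poly ([:0, 1, -1:] * p) x)"
          for x
        by (simp add: f_def algebra_simps)
      then show ?thesis unfolding poly_inner_def by (simp only: integral_mult_right)
    qed
    moreover have "integral {0..1} (\<lambda>x. poly p x * g x) = product_functional ([:0, 1, -1:] * p)"
    proof -
      have "((\<lambda>x. poly p x * g x) has_integral product_functional ([:0, 1, -1:] * p)) {0<..<1}"
        by (rule has_integral_eq[OF _ has_integral_product_functional])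
           (simp add: g_eq algebra_simps)
      then show ?thesis by (simp add: integral_unique flip: has_integral_Icc_iff_Ioo)
    qed
    ultimately show "(\<lambda>m. integral {0..1} (\<lambda>x. poly p x * f m x)) sums
        integral {0..1} (\<lambda>x. poly p x * g x)"
      using product_functional_sums[of "[:0, 1, -1:] * p"] by (simp only: expansion_coeff_def)
  qed (use g assms in auto)
  then have "(\<lambda>m. 1 / (x * (1 - x)) * f m x) sums (1 / (x * (1 - x)) * g x)" by (rule sums_mult)
  then show ?thesis using assms by (simp add: f_def g_eq)
qed

lemma Gamma_term_minus_of_real_sums_hyp:
  "Gamma_term (- of_real a) sums of_real (- (2 / sin (pi * a) * (hyp (1/2))\<^sup>2))"
proof -
  have "(\<lambda>m. - (2 / sin (pi * a)
      * (expansion_coeff m * poly (shifted_legendre (2 * m)) (1/2)))) sums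
      - (2 / sin (pi * a) * hyp_product (1/2))"
    by (intro sums_minus sums_mult hyp_product_expansion) auto
  moreover have "hyp_product (1/2) = (hyp (1/2))\<^sup>2"
    by (simp add: hyp_product_def power2_eq_square)
  moreover have "- (2 / sin (pi * a)
      * (expansion_coeff m * poly (shifted_legendre (2 * m)) (1/2))) =
      (-1) ^ (m + 1) * (ncbinom m ^ 3 * (4 * real m + 1) * Gamma_weight m)" for m
    using sin_pi_a_pos
    by (simp add: expansion_coeff_eq poly_shifted_legendre poly_legendre_even_0 power2_eq_square
        power3_eq_cube)
  ultimately show ?thesis
    unfolding Gamma_term_minus_of_real[abs_def] by (simp only: sums_of_real)
qed

lemma hyp_half_square:
  "(hyp (1/2))\<^sup>2 = (cos (pi * a / 2) * Gamma_half_quotient ((1 - a) / 2))\<^sup>2 / pi"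
proof -
  have pos: "0 < Gamma ((1 + a) / 2)" "0 < Gamma ((1 - a) / 2)" "0 < cos (pi * a / 2)"
    using a_pos a_less_1 by (auto intro!: cos_gt_zero)
  have "hyp (1/2) = sqrt pi / (Gamma ((1 + a) / 2) * Gamma (1 - a / 2))"
    using sums_unique2[OF hyp_sums[of "1/2"]]
      hypergeometric_midpoint_sums[OF a_pos a_less_1, folded hyp_coeff_def]
    by simp
  moreover have "Gamma ((1 + a) / 2) * Gamma ((1 - a) / 2) = pi / cos (pi * a / 2)"
    using Gamma_reflection_real[of "(1 + a) / 2"] sin_add[of "pi / 2" "pi * a / 2"]
    by (simp add: field_simps)
  then have "1 / Gamma ((1 + a) / 2) = cos (pi * a / 2) * Gamma ((1 - a) / 2) / pi"
    using pos by (simp add: field_simps)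
  moreover have "(1 - a) / 2 + 1/2 = 1 - a / 2" by (simp add: field_simps)
  then have "Gamma_half_quotient ((1 - a) / 2) = Gamma ((1 - a) / 2) / Gamma (1 - a / 2)"
    by (simp only: Gamma_half_quotient_def rGamma_inverse_Gamma divide_inverse)
  moreover have "s / (x * y) = s * (1 / x) * (1 / y)" "c * z / p * (1 / y) = c * (z / y) / p"
    for c p s x y z :: real
    by simp_all
  ultimately have "hyp (1/2) =
      sqrt pi * (cos (pi * a / 2) * Gamma_half_quotient ((1 - a) / 2) / pi)"
    by (simp only: mult.assoc)
  then show ?thesis by (simp add: power_mult_distrib power_divide power2_eq_square[of pi])
qed

end

section \<open>Analytic continuation\<close>

lemma cot_Gamma_eq:
  "cot_Gamma \<nu> = cot (of_real pi * \<nu> / 2) * (Gamma_half_quotient ((1 + \<nu>) / 2))\<^sup>2 / of_real pi"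
proof -
  have "(1 + \<nu>) / 2 + 1/2 = (2 + \<nu>) / 2" by (simp add: field_simps)
  then have "Gamma_half_quotient ((1 + \<nu>) / 2) = Gamma ((1 + \<nu>) / 2) / Gamma ((2 + \<nu>) / 2)"
    by (simp only: Gamma_half_quotient_def rGamma_inverse_Gamma divide_inverse)
  then show ?thesis by (simp add: cot_Gamma_def power_divide)
qed

lemma (in legendre_function) Gamma_term_minus_of_real_sums:
  "Gamma_term (- of_real a) sums cot_Gamma (- of_real a)"
proof -
  define h where "h = Gamma_half_quotient ((1 - a) / 2)"
  have pos: "0 < sin (pi * a / 2)" "0 < cos (pi * a / 2)"
    using a_pos a_less_1 by (auto intro!: sin_gt_zero cos_gt_zero)
  have "sin (pi * a) = 2 * sin (pi * a / 2) * cos (pi * a / 2)"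
    using sin_double[of "pi * a / 2"] by simp
  then have real_value: "2 / sin (pi * a) * (hyp (1/2))\<^sup>2 = cot (pi * a / 2) * h\<^sup>2 / pi"
    unfolding hyp_half_square h_def cot_def using pos by (simp add: power2_eq_square field_simps)
  have "(1 + - complex_of_real a) / 2 = of_real ((1 - a) / 2)"
    "of_real pi * (- complex_of_real a) / 2 = - of_real (pi * a / 2)"
    by simp_all
  moreover have "cot (- complex_of_real (pi * a / 2)) = of_real (- cot (pi * a / 2))"
    by (simp only: cot_def sin_minus cos_minus sin_of_real cos_of_real) simp
  ultimately have "cot_Gamma (- of_real a) = of_real (- (cot (pi * a / 2) * h\<^sup>2 / pi))"
    unfolding cot_Gamma_eq h_def by (simp only: Gamma_half_quotient_of_real) simp
  then show ?thesis using Gamma_term_minus_of_real_sums_hyp unfolding real_value by simp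
qed

lemma sin_half_pi_eq_0_iff: "sin (of_real pi * \<nu> / 2) = (0::complex) \<longleftrightarrow> (\<exists>n. \<nu> = 2 * of_int n)"
proof -
  have "of_real pi * \<nu> / 2 = of_real (of_int n * pi) \<longleftrightarrow> \<nu> = 2 * of_int n" for n
    by (auto simp: field_simps)
  then show ?thesis unfolding sin_eq_0 by simp
qed

definition cot_Gamma_poles :: "complex set" where
  "cot_Gamma_poles = {1 - 2 * of_nat n | n::nat. n \<ge> 1} \<union> {2 * of_nat n | n::nat. True}"

lemma not_cot_Gamma_poles_imp:
  assumes "\<nu> \<notin> cot_Gamma_poles"
  shows "- \<nu> / 2 \<notin> \<int>\<^sub>\<le>\<^sub>0" "(1 + \<nu>) / 2 \<notin> \<int>\<^sub>\<le>\<^sub>0"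
proof -
  have "\<nu> = 2 * of_nat n" if "- \<nu> / 2 = - of_nat n" for n using that by (simp add: field_simps)
  then show "- \<nu> / 2 \<notin> \<int>\<^sub>\<le>\<^sub>0"
    using assms unfolding cot_Gamma_poles_def by (blast elim!: nonpos_Ints_cases')
  have "\<nu> = 1 - 2 * of_nat (n + 1)" if "(1 + \<nu>) / 2 = - of_nat n" for n
  proof -
    have "\<nu> = 2 * ((1 + \<nu>) / 2) - 1" by (simp add: field_simps)
    also have "\<dots> = 1 - 2 * of_nat (n + 1)" unfolding that by simp
    finally show ?thesis .
  qed
  then show "(1 + \<nu>) / 2 \<notin> \<int>\<^sub>\<le>\<^sub>0"
    using assms unfolding cot_Gamma_poles_def by (fastforce elim!: nonpos_Ints_cases')
qed

text \<open>By the reflection formula the zeros of \<open>1 / \<Gamma>((2 + \<nu>) / 2)\<^sup>2\<close> cancel the poles of the cotangent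
  at the negative even integers.\<close>
definition continued_cot_Gamma :: "complex \<Rightarrow> complex" where
  "continued_cot_Gamma \<nu> = - (cos (of_real pi * \<nu> / 2) * Gamma (- \<nu> / 2) *
     (Gamma ((1 + \<nu>) / 2))\<^sup>2 * rGamma ((2 + \<nu>) / 2) / (of_real pi)\<^sup>2)"

lemma isCont_continued_cot_Gamma:
  assumes "\<nu> \<notin> cot_Gamma_poles"
  shows "isCont continued_cot_Gamma \<nu>"
  unfolding continued_cot_Gamma_def
  using not_cot_Gamma_poles_imp[OF assms] by (intro continuous_intros) auto

lemma cot_Gamma_eq_continued:
  assumes "sin (of_real pi * \<nu> / 2) \<noteq> (0::complex)"
  shows "cot_Gamma \<nu> = continued_cot_Gamma \<nu>"
proof -
  define s where "s = sin (of_real pi * \<nu> / 2)"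
  have "- \<nu> / 2 \<notin> \<int>\<^sub>\<le>\<^sub>0"
  proof
    assume "- \<nu> / 2 \<in> \<int>\<^sub>\<le>\<^sub>0"
    then obtain n where n: "- \<nu> / 2 = of_int n" by (auto elim: nonpos_Ints_cases)
    have "\<nu> = - 2 * (- \<nu> / 2)" by simp
    also have "\<dots> = 2 * of_int (- n)" unfolding n by simp
    finally show False using assms sin_half_pi_eq_0_iff by blast
  qed
  then have "rGamma (- \<nu> / 2) * Gamma (- \<nu> / 2) = 1"
    by (simp add: rGamma_inverse_Gamma Gamma_eq_zero_iff)
  moreover have "rGamma (- \<nu> / 2) * rGamma ((2 + \<nu>) / 2) = - s / of_real pi"
  proof -
    have complement: "1 - - \<nu> / 2 = (2 + \<nu>) / 2" by (simp add: field_simps)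
    show ?thesis
      using rGamma_reflection_complex[of "- \<nu> / 2"] unfolding complement by (simp add: s_def)
  qed
  ultimately have reflection: "rGamma ((2 + \<nu>) / 2) = - s / of_real pi * Gamma (- \<nu> / 2)"
    by (metis mult.assoc mult.commute mult_1)
  have "cot_Gamma \<nu> = cos (of_real pi * \<nu> / 2) / s * (Gamma ((1 + \<nu>) / 2))\<^sup>2 *
      (rGamma ((2 + \<nu>) / 2) * rGamma ((2 + \<nu>) / 2)) / of_real pi"
    by (simp add: cot_Gamma_def cot_def s_def rGamma_inverse_Gamma power2_eq_square field_simps)
  also have "\<dots> = continued_cot_Gamma \<nu>"
    unfolding continued_cot_Gamma_def using assms
    by (subst reflection) (simp add: power2_eq_square flip: s_def)
  finally show ?thesis .
qed

lemma cot_Gamma_eq_continued_not_Ints: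
  assumes "\<nu> \<notin> \<int>"
  shows "cot_Gamma \<nu> = continued_cot_Gamma \<nu>"
  using assms by (intro cot_Gamma_eq_continued) (auto simp: sin_half_pi_eq_0_iff)

lemma cot_Gamma_poles_subset_Ints: "cot_Gamma_poles \<subseteq> \<int>"
  by (auto simp: cot_Gamma_poles_def)

lemma cot_Gamma_holomorphic: "cot_Gamma holomorphic_on - \<int>"
proof (rule holomorphic_transform)
  have "- \<nu> / 2 \<notin> \<int>\<^sub>\<le>\<^sub>0" "(1 + \<nu>) / 2 \<notin> \<int>\<^sub>\<le>\<^sub>0" if "\<nu> \<in> - \<int>" for \<nu> :: complex
    using that not_cot_Gamma_poles_imp[of \<nu>] cot_Gamma_poles_subset_Ints by auto
  then show "continued_cot_Gamma holomorphic_on - \<int>"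
    unfolding continued_cot_Gamma_def by (intro holomorphic_intros) simp_all
qed (simp add: cot_Gamma_eq_continued_not_Ints)

lemma Gamma_term_sums:
  assumes "\<nu> \<notin> \<int>"
  shows "Gamma_term \<nu> sums cot_Gamma \<nu>"
proof -
  define U where "U = complex_of_real ` {-1<..<0}"
  define \<xi> where "\<xi> = complex_of_real (- 1/2)"
  have "\<xi> \<in> U" unfolding U_def \<xi>_def by (rule imageI) simp
  have U_subset: "U \<subseteq> - \<int>"
  proof -
    have "y \<notin> \<int>" if "y \<in> {-1<..<0}" for y :: real
      using that by (auto elim!: Ints_cases)
    then show ?thesis by (auto simp: U_def of_real_in_Ints_iff)
  qed
  have "(\<Sum>m. Gamma_term \<nu> m) - cot_Gamma \<nu> = 0"
  proof (rule analytic_continuation[of "\<lambda>\<nu>. (\<Sum>m. Gamma_term \<nu> m) - cot_Gamma \<nu>" "- \<int>" U \<xi>])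
    show "(\<lambda>\<nu>. (\<Sum>m. Gamma_term \<nu> m) - cot_Gamma \<nu>) holomorphic_on - \<int>"
      by (intro holomorphic_intros suminf_Gamma_term_holomorphic cot_Gamma_holomorphic)
    have "countable (\<int> :: complex set)" by (simp add: Ints_def)
    then show "connected (- \<int> :: complex set)"
      using connected_open_diff_countable[of "UNIV :: complex set" "\<int>"]
      by (simp add: Compl_eq_Diff_UNIV connected_UNIV)
    have "connected U" unfolding U_def
      by (intro connected_continuous_image continuous_intros) simp
    moreover have "complex_of_real (- 1/4) \<in> U" unfolding U_def by (rule imageI) simp
    moreover have "complex_of_real (- 1/4) \<noteq> \<xi>" unfolding \<xi>_def of_real_eq_iff by simp
    ultimately show "\<xi> islimpt U" using \<open>\<xi> \<in> U\<close> by (intro connected_imp_perfect) auto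
    show "(\<Sum>m. Gamma_term z m) - cot_Gamma z = 0" if z: "z \<in> U" for z
    proof -
      obtain y where y: "z = of_real y" "y \<in> {-1<..<0}" using z unfolding U_def by blast
      then interpret legendre_function "- y" by unfold_locales auto
      show ?thesis using Gamma_term_minus_of_real_sums y(1) by (simp add: sums_iff)
    qed
  qed (use assms U_subset \<open>\<xi> \<in> U\<close> open_Compl_Ints in auto)
  then show ?thesis
    using summable_norm_cancel[OF summable_norm_Gamma_term] by (simp add: sums_iff)
qed

lemma Gamma_term_limit:
  assumes "\<nu> \<notin> cot_Gamma_poles"
  shows "(cot_Gamma \<longlongrightarrow> continued_cot_Gamma \<nu>) (at \<nu>)"
    and "((\<lambda>\<mu>. \<Sum>m. Gamma_term \<mu> m) \<longlongrightarrow> continued_cot_Gamma \<nu>) (at \<nu>)"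
proof -
  have "\<forall>\<^sub>F \<mu> in at \<nu>. \<mu> \<in> - (\<int> - {\<nu>}) - {\<nu>}"
    by (intro eventually_at_in_open open_Compl closed_subset_Ints) auto
  then have not_Ints: "\<forall>\<^sub>F \<mu> in at \<nu>. \<mu> \<notin> \<int>" by eventually_elim auto
  have continued: "(continued_cot_Gamma \<longlongrightarrow> continued_cot_Gamma \<nu>) (at \<nu>)"
    using isCont_continued_cot_Gamma[OF assms] by (simp add: isCont_def)
  show "(cot_Gamma \<longlongrightarrow> continued_cot_Gamma \<nu>) (at \<nu>)"
    by (rule Lim_transform_eventually[OF continued], use not_Ints in eventually_elim)
       (simp add: cot_Gamma_eq_continued_not_Ints)
  then show "((\<lambda>\<mu>. \<Sum>m. Gamma_term \<mu> m) \<longlongrightarrow> continued_cot_Gamma \<nu>) (at \<nu>)"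
    by (rule Lim_transform_eventually, use not_Ints in eventually_elim)
       (use Gamma_term_sums in \<open>simp add: sums_iff\<close>)
qed

lemma continued_cot_Gamma_eq_if_Re_pos:
  assumes "\<nu> \<notin> cot_Gamma_poles" "0 < Re \<nu>"
  shows "continued_cot_Gamma \<nu> = cot_Gamma \<nu>"
proof (rule cot_Gamma_eq_continued[symmetric], rule notI)
  assume "sin (of_real pi * \<nu> / 2) = 0"
  then obtain n where n: "\<nu> = 2 * of_int n" unfolding sin_half_pi_eq_0_iff ..
  then have "0 < n" using assms(2) by simp
  then have "\<nu> = 2 * of_nat (nat n)" using n by (simp add: of_nat_nat)
  then show False using assms(1) unfolding cot_Gamma_poles_def by blast
qed

section \<open>Complete elliptic integrals\<close>

lemma has_integral_sin_power_even:
  "((\<lambda>t. sin t ^ (2 * k)) has_integral pi / 2 * ncbinom k) {0..pi/2}"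
proof (induction k)
  case 0
  show ?case using has_integral_const_real[of "1::real" 0 "pi/2"] by simp
next
  case (Suc k)
  define F where "F t = sin t ^ (2 * k + 1) * cos t" for t :: real
  define f where "f t = real (2 * k + 1) * sin t ^ (2 * k)
      - real (2 * k + 2) * sin t ^ (2 * Suc k)" for t :: real
  have "(F has_real_derivative f t) (at t)" for t
    unfolding F_def
  proof (rule DERIV_cong[OF DERIV_mult[OF DERIV_power[OF DERIV_sin] DERIV_cos]])
    have "real (2 * k + 1) * (cos t * sin t ^ (2 * k + 1 - Suc 0)) * cos t +
        - sin t * sin t ^ (2 * k + 1) =
        real (2 * k + 1) * sin t ^ (2 * k) * (cos t)\<^sup>2 - sin t ^ (2 * k) * (sin t)\<^sup>2"
      by (simp add: power2_eq_square)
    also have "\<dots> = f t"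
      unfolding cos_squared_eq f_def by (simp add: power2_eq_square algebra_simps)
    finally show "real (2 * k + 1) * (cos t * sin t ^ (2 * k + 1 - Suc 0)) * cos t +
        - sin t * sin t ^ (2 * k + 1) = f t" .
  qed
  then have "(f has_integral F (pi/2) - F 0) {0..pi/2}"
    by (intro fundamental_theorem_of_calculus)
       (auto intro: has_field_derivative_at_within simp
           flip: has_real_derivative_iff_has_vector_derivative)
  then have "(f has_integral 0) {0..pi/2}" by (simp add: F_def)
  from has_integral_diff[OF has_integral_mult_right[OF Suc.IH, of "real (2 * k + 1)"] this]
  have "((\<lambda>t. real (2 * k + 2) * sin t ^ (2 * Suc k)) has_integral
      real (2 * k + 1) * (pi / 2 * ncbinom k)) {0..pi/2}"
    by (simp add: f_def)
  from has_integral_mult_right[OF this, of "1 / real (2 * k + 2)"]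
  show ?case by (simp add: ncbinom_Suc ac_simps)
qed

lemma inverse_sqrt_sums:
  fixes x :: real
  assumes "\<bar>x\<bar> < 1"
  shows "(\<lambda>k. ncbinom k * x ^ k) sums (1 / sqrt (1 - x))"
proof -
  have "(1 - x) powr (- (1/2)) = 1 / sqrt (1 - x)"
    using assms by (simp add: powr_minus powr_half_sqrt inverse_eq_divide)
  then show ?thesis
    using binomial_series_pochhammer[OF assms, of "1/2"] by (simp add: ncbinom_eq_pochhammer)
qed

lemma AE_elliptic_integrand_eq_suminf:
  assumes "0 \<le> x" "x \<le> 1"
  shows "AE t in lborel. ennreal (1 / sqrt (1 - x * (sin t)\<^sup>2)) * indicator {0..pi/2} t =
    (\<Sum>k. ennreal (ncbinom k * (x * (sin t)\<^sup>2) ^ k) * indicator {0..pi/2} t)"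
  using AE_lborel_singleton[of "pi/2"]
proof eventually_elim
  case (elim t)
  show ?case
  proof (cases "t \<in> {0..pi/2}")
    case True
    then have "0 \<le> sin t" "sin t < 1"
      using elim sin_monotone_2pi[of t "pi/2"] by (auto intro: sin_ge_zero)
    then have "(sin t)\<^sup>2 < 1" by (simp add: abs_square_less_1)
    moreover have "x * (sin t)\<^sup>2 \<le> (sin t)\<^sup>2" using assms by (intro mult_left_le_one_le) auto
    ultimately have "x * (sin t)\<^sup>2 < 1" by linarith
    then have "(\<lambda>k. ncbinom k * (x * (sin t)\<^sup>2) ^ k) sums (1 / sqrt (1 - x * (sin t)\<^sup>2))"
      using assms by (intro inverse_sqrt_sums) simp
    then have "(\<Sum>k. ennreal (ncbinom k * (x * (sin t)\<^sup>2) ^ k)) =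
        ennreal (1 / sqrt (1 - x * (sin t)\<^sup>2))"
      using assms by (intro suminf_ennreal_eq) auto
    then show ?thesis using True by simp
  qed simp
qed

lemma ellK_eq_suminf:
  assumes "0 \<le> x" "x \<le> 1"
  shows "ellK x = (\<Sum>k. ennreal (pi / 2 * (ncbinom k)\<^sup>2 * x ^ k))"
proof -
  let ?f = "\<lambda>k t. ncbinom k * (x * (sin t)\<^sup>2) ^ k"
  have "ellK x = (\<integral>\<^sup>+ t. (\<Sum>k. ennreal (?f k t) * indicator {0..pi/2} t) \<partial>lborel)"
    unfolding ellK_def by (rule nn_integral_cong_AE[OF AE_elliptic_integrand_eq_suminf[OF assms]])
  also have "\<dots> = (\<Sum>k. \<integral>\<^sup>+ t. ennreal (?f k t) * indicator {0..pi/2} t \<partial>lborel)"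
    by (intro nn_integral_suminf) measurable
  also have "\<dots> = (\<Sum>k. ennreal (pi / 2 * (ncbinom k)\<^sup>2 * x ^ k))"
  proof (intro suminf_cong nn_integral_has_integral_lebesgue')
    fix k
    have "((\<lambda>t. ncbinom k * x ^ k * sin t ^ (2 * k)) has_integral
        ncbinom k * x ^ k * (pi / 2 * ncbinom k)) {0..pi/2}"
      by (intro has_integral_mult_right has_integral_sin_power_even)
    then show "(?f k has_integral pi / 2 * (ncbinom k)\<^sup>2 * x ^ k) {0..pi/2}"
      by (simp add: power_mult_distrib power_mult power2_eq_square mult_ac)
  qed (use assms in simp)
  finally show ?thesis .
qed

interpretation half: legendre_function "1/2"
  by unfold_locales auto

lemma half_hyp_coeff: "half.hyp_coeff k = (ncbinom k)\<^sup>2"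
  by (simp add: half.hyp_coeff_def hypergeometric_coeff_def ncbinom_eq_pochhammer power2_eq_square
      pochhammer_fact)

lemma half_Gamma_weight: "half.Gamma_weight m = pi * (ncbinom m)\<^sup>2"
proof -
  have "Gamma (real m + 1/2) = pochhammer (1/2) m * sqrt pi"
    using Gamma_plus_of_nat_real[of "1/2" m] by (simp add: Gamma_one_half_real add.commute)
  moreover have "Gamma (real m + 1) = fact m"
    using Gamma_fact[of m, where 'a = real] by (simp add: add.commute)
  moreover have "real m + 1/2 + 1/2 = real m + 1" by simp
  ultimately have "Gamma_half_quotient (real m + 1/2) = pochhammer (1/2) m * sqrt pi / fact m"
    by (simp only: Gamma_half_quotient_def rGamma_inverse_Gamma divide_inverse)
  then have "Gamma_half_quotient (real m + 1/2) = sqrt pi * ncbinom m"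
    by (simp add: ncbinom_eq_pochhammer)
  moreover have "real m + 1 - 1/2 = real m + 1/2" by simp
  ultimately have "half.Gamma_weight m = (sqrt pi * ncbinom m) * (sqrt pi * ncbinom m)"
    unfolding half.Gamma_weight_def by (simp only:)
  then show ?thesis by (simp add: power2_eq_square)
qed

lemma half_expansion_coeff: "half.expansion_coeff m = pi / 2 * (ncbinom m ^ 4 * (4 * real m + 1))"
  by (simp add: half.expansion_coeff_eq half_Gamma_weight power2_eq_square power4_eq_xxxx)

lemma ellK_eq_hyp:
  assumes "0 \<le> x" "x < 1"
  shows "ellK x = ennreal (pi / 2 * half.hyp x)"
proof -
  have "(\<lambda>k. pi / 2 * (ncbinom k)\<^sup>2 * x ^ k) sums (pi / 2 * half.hyp x)"
    using sums_mult[OF half.hyp_sums[OF assms], of "pi / 2"] by (simp add: half_hyp_coeff mult_ac)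
  then have "(\<Sum>k. ennreal (pi / 2 * (ncbinom k)\<^sup>2 * x ^ k)) = ennreal (pi / 2 * half.hyp x)"
    using assms by (intro suminf_ennreal_eq) auto
  then show ?thesis using assms by (simp add: ellK_eq_suminf)
qed

lemma not_summable_imp_ereal_sums_PInfty:
  assumes "\<And>m. 0 \<le> f m" "\<not> summable f"
  shows "(\<lambda>m. ereal (f m)) sums \<infinity>"
proof -
  have "(\<Sum>m. ennreal (f m)) = top" using summable_suminf_not_top[of f] assms by blast
  then have "(\<lambda>m. enn2ereal (ennreal (f m))) sums enn2ereal top"
    using summable_sums[OF summableI, of "\<lambda>m. ennreal (f m)"] by (simp only: sums_enn2ereal)
  then show ?thesis using assms(1) by (simp add: enn2ereal_ennreal)
qed

lemma ellK_0: "ellK 0 = ennreal (pi / 2)"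
proof -
  have "half.hyp 0 = 1" unfolding half.hyp_def by (subst suminf_finite[of "{0}"]) auto
  then show ?thesis using ellK_eq_hyp[of 0] by simp
qed

lemma ellK_1: "ellK 1 = \<infinity>"
proof (rule ccontr)
  assume "ellK 1 \<noteq> \<infinity>"
  then have "(\<Sum>k. ennreal (pi / 2 * (ncbinom k)\<^sup>2)) \<noteq> top" by (simp add: ellK_eq_suminf)
  then have "summable (\<lambda>k. pi / 2 * (ncbinom k)\<^sup>2)" by (intro summable_suminf_not_top) auto
  then show False using not_summable_ncbinom_square by simp
qed

definition ellK_product_term :: "real \<Rightarrow> nat \<Rightarrow> real" where
  "ellK_product_term x m =
     pi ^ 3 / 8 * (ncbinom m ^ 4 * (4 * real m + 1) * poly (legendre (2 * m)) (2 * x - 1))"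

lemma ellK_product_sums_Ioo:
  assumes "0 < x" "x < 1"
  shows "(\<lambda>m. ereal (ellK_product_term x m)) sums enn2ereal (ellK x * ellK (1 - x))"
proof -
  have nonneg: "0 \<le> half.hyp x" "0 \<le> half.hyp (1 - x)"
    using assms by (auto intro: half.hyp_nonneg)
  have "pi\<^sup>2 / 4 * (half.expansion_coeff m * poly (shifted_legendre (2 * m)) x) =
      ellK_product_term x m" for m
    unfolding half_expansion_coeff poly_shifted_legendre ellK_product_term_def
    by (simp add: power2_eq_square power3_eq_cube)
  then have "ellK_product_term x sums (pi\<^sup>2 / 4 * half.hyp_product x)"
    using sums_mult[OF half.hyp_product_expansion[OF assms], of "pi\<^sup>2 / 4"] by (simp only:)
  moreover have "ellK x * ellK (1 - x) = ennreal (pi\<^sup>2 / 4 * half.hyp_product x)"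
    using assms nonneg
    by (simp add: ellK_eq_hyp ennreal_mult[symmetric] half.hyp_product_def power2_eq_square mult_ac)
  moreover have "0 \<le> half.hyp_product x" using nonneg by (simp add: half.hyp_product_def)
  ultimately show ?thesis by (simp add: enn2ereal_ennreal sums_ereal)
qed

lemma ellK_product_sums_endpoint:
  assumes "x = 0 \<or> x = 1"
  shows "(\<lambda>m. ereal (ellK_product_term x m)) sums enn2ereal (ellK x * ellK (1 - x))"
proof -
  have term_eq: "ellK_product_term x m = pi ^ 3 / 8 * (ncbinom m ^ 4 * (4 * real m + 1))" for m
    using assms poly_legendre_minus[of "2 * m" 1] by (auto simp: ellK_product_term_def)
  have "\<not> summable (ellK_product_term x)"
  proof
    assume "summable (ellK_product_term x)"
    then have "summable (\<lambda>m. 8 / pi ^ 3 * ellK_product_term x m)" by (rule summable_mult)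
    then have "summable (\<lambda>m. (ncbinom m)\<^sup>2)"
    proof (rule summable_comparison_test'[where N = 0])
      fix m
      have "1 \<le> (4 * real m + 1) * (ncbinom m)\<^sup>2"
        using ncbinom_square_ge[of m] by (simp add: field_simps)
      then have "(ncbinom m)\<^sup>2 * 1 \<le> (ncbinom m)\<^sup>2 * ((4 * real m + 1) * (ncbinom m)\<^sup>2)"
        by (rule mult_left_mono) simp
      also have "\<dots> = 8 / pi ^ 3 * ellK_product_term x m"
        by (simp add: term_eq power2_eq_square power4_eq_xxxx)
      finally show "norm ((ncbinom m)\<^sup>2) \<le> 8 / pi ^ 3 * ellK_product_term x m" by simp
    qed
    then show False using not_summable_ncbinom_square by simp
  qed
  moreover have "0 \<le> ellK_product_term x m" for m by (simp add: term_eq)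
  ultimately have "(\<lambda>m. ereal (ellK_product_term x m)) sums \<infinity>"
    by (intro not_summable_imp_ereal_sums_PInfty)
  moreover have "ellK x * ellK (1 - x) = top"
    using assms by (auto simp: ellK_0 ellK_1 ennreal_mult_eq_top_iff)
  ultimately show ?thesis by simp
qed

lemma ellK_product_sums:
  assumes "x \<in> {0..1}"
  shows "(\<lambda>m. ereal (ellK_product_term x m)) sums enn2ereal (ellK x * ellK (1 - x))"
  using assms ellK_product_sums_Ioo[of x] ellK_product_sums_endpoint[of x] by fastforce

theorem theorem2p2:
  shows
    "(\<forall>\<nu>::complex.
        \<nu> \<notin> {1 - 2 * of_nat n | n::nat. n \<ge> 1} \<union> {2 * of_nat n | n::nat. True} \<longrightarrow>
          (\<nu> \<notin> \<int> \<longrightarrow> Gamma_term \<nu> sums cot_Gamma \<nu>) \<and>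
          (\<nu> \<in> \<int> \<longrightarrow>
             (\<exists>c. (cot_Gamma \<longlongrightarrow> c) (at \<nu>) \<and>
                  (0 < Re \<nu> \<longrightarrow> c = cot_Gamma \<nu>) \<and>
                  ((\<lambda>\<mu>. \<Sum>m. Gamma_term \<mu> m) \<longlongrightarrow> c) (at \<nu>))))
     \<and>
     (\<forall>x::real. x \<in> {0..1} \<longrightarrow>
        (\<lambda>m. ereal (pi ^ 3 / 8 *
               (ncbinom m ^ 4 * (4 * real m + 1) * poly (legendre (2 * m)) (2 * x - 1))))
        sums enn2ereal (ellK x * ellK (1 - x)))"
  unfolding cot_Gamma_poles_def[symmetric] ellK_product_term_def[symmetric]
proof (intro conjI allI impI)
  fix \<nu> :: complex
  assume \<nu>: "\<nu> \<notin> cot_Gamma_poles"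
  show "Gamma_term \<nu> sums cot_Gamma \<nu>" if "\<nu> \<notin> \<int>"
    using that by (rule Gamma_term_sums)
  show "\<exists>c. (cot_Gamma \<longlongrightarrow> c) (at \<nu>) \<and> (0 < Re \<nu> \<longrightarrow> c = cot_Gamma \<nu>) \<and>
      ((\<lambda>\<mu>. \<Sum>m. Gamma_term \<mu> m) \<longlongrightarrow> c) (at \<nu>)"
    using Gamma_term_limit[OF \<nu>] continued_cot_Gamma_eq_if_Re_pos[OF \<nu>] by blast
qed (rule ellK_product_sums)

end
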